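(* Let $G$ and $H$ be finite groups with $|G| = |H| = N$. For a finite group $X$ and an integer $n \ge 1$, define \[ m_n(X) = \sum_{\chi_1,\dots,\chi_n \in \mathrm{Irr}(X)} \Big[1_X,\ \prod_{i=1}^{n} \chi_i\overline{\chi_i}\Big], \qquad r_n(X) = \sum_{\chi_1,\dots,\chi_n \in \mathrm{Irr}(X)} \Big[1_X,\ \prod_{i=1}^{n} \chi_i^{2}\Big], \] where the sums run over all $n$-tuples of irreducible complex characters (repetition allowed). (1) If $m_n(G) = m_n(H)$ for all $n = 1,2,\dots,N$, then for every positive integer $k$ the number of conjugacy classes of $G$ of size $k$ equals the number of conjugacy classes of $H$ of size $k$. (2) If $r_n(G) = r_n(H)$ for all $n = 1,2,\dots,N$, then for every positive integer $k$ the number of real conjugacy classes of $G$ of size $k$ equals the number of real conjugacy classes of $H$ of size $k$.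
   Context: For a finite group $X$, $\mathrm{Irr}(X)$ is the set of irreducible complex characters of $X$, $1_X$ is the trivial character, $\overline{\chi}$ is the complex conjugate character, and for class functions $\alpha,\beta$ on $X$, $[\alpha,\beta] = \frac{1}{|X|}\sum_{x\in X}\alpha(x)\overline{\beta(x)}$ is the usual inner product (so $[1_X,\theta]$ is the multiplicity of the trivial character in a character $\theta$). A conjugacy class $K$ of $X$ is real if $K = K^{-1} = \{x^{-1} : x \in K\}$. *)

theory Defs
  imports "HOL-Algebra.Group" "Jordan_Normal_Form.Matrix"
begin

definition mat_trace :: "complex mat \<Rightarrow> complex" where
  "mat_trace A = (\<Sum>i<dim_row A. A $$ (i, i))"

definition is_rep :: "('a, 'b) monoid_scheme \<Rightarrow> nat \<Rightarrow> ('a \<Rightarrow> complex mat) \<Rightarrow> bool" where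
  "is_rep G d \<rho> \<longleftrightarrow>
     (\<forall>x\<in>carrier G. \<rho> x \<in> carrier_mat d d) \<and>
     \<rho> \<one>\<^bsub>G\<^esub> = 1\<^sub>m d \<and>
     (\<forall>x\<in>carrier G. \<forall>y\<in>carrier G. \<rho> (x \<otimes>\<^bsub>G\<^esub> y) = \<rho> x * \<rho> y)"

definition is_subspace :: "nat \<Rightarrow> complex vec set \<Rightarrow> bool" where
  "is_subspace d W \<longleftrightarrow> W \<subseteq> carrier_vec d \<and> 0\<^sub>v d \<in> W \<and>
     (\<forall>v\<in>W. \<forall>w\<in>W. v + w \<in> W) \<and> (\<forall>c. \<forall>v\<in>W. c \<cdot>\<^sub>v v \<in> W)"

definition irreducible_rep :: "('a, 'b) monoid_scheme \<Rightarrow> nat \<Rightarrow> ('a \<Rightarrow> complex mat) \<Rightarrow> bool" where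
  "irreducible_rep G d \<rho> \<longleftrightarrow> is_rep G d \<rho> \<and> d > 0 \<and>
     (\<forall>W. is_subspace d W \<and> (\<forall>x\<in>carrier G. \<forall>w\<in>W. \<rho> x *\<^sub>v w \<in> W)
          \<longrightarrow> W = {0\<^sub>v d} \<or> W = carrier_vec d)"

definition Irr :: "('a, 'b) monoid_scheme \<Rightarrow> ('a \<Rightarrow> complex) set" where
  "Irr G = {\<chi>. \<exists>d \<rho>. irreducible_rep G d \<rho> \<and> \<chi> = (\<lambda>x\<in>carrier G. mat_trace (\<rho> x))}"

definition char_inner :: "('a, 'b) monoid_scheme \<Rightarrow> ('a \<Rightarrow> complex) \<Rightarrow> ('a \<Rightarrow> complex) \<Rightarrow> complex" where
  "char_inner G \<alpha> \<beta> = (\<Sum>x\<in>carrier G. \<alpha> x * cnj (\<beta> x)) / of_nat (card (carrier G))"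

definition m_n :: "nat \<Rightarrow> ('a, 'b) monoid_scheme \<Rightarrow> complex" where
  "m_n n G = (\<Sum>\<chi>s\<in>Pi\<^sub>E {..<n} (\<lambda>_. Irr G).
      char_inner G (\<lambda>_. 1) (\<lambda>x. \<Prod>i<n. \<chi>s i x * cnj (\<chi>s i x)))"

definition r_n :: "nat \<Rightarrow> ('a, 'b) monoid_scheme \<Rightarrow> complex" where
  "r_n n G = (\<Sum>\<chi>s\<in>Pi\<^sub>E {..<n} (\<lambda>_. Irr G).
      char_inner G (\<lambda>_. 1) (\<lambda>x. \<Prod>i<n. (\<chi>s i x)^2))"

definition conj_class :: "('a, 'b) monoid_scheme \<Rightarrow> 'a \<Rightarrow> 'a set" where
  "conj_class G x = {g \<otimes>\<^bsub>G\<^esub> x \<otimes>\<^bsub>G\<^esub> inv\<^bsub>G\<^esub> g | g. g \<in> carrier G}"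

definition conj_classes :: "('a, 'b) monoid_scheme \<Rightarrow> 'a set set" where
  "conj_classes G = conj_class G ` carrier G"

definition real_class :: "('a, 'b) monoid_scheme \<Rightarrow> 'a set \<Rightarrow> bool" where
  "real_class G K \<longleftrightarrow> (\<lambda>x. inv\<^bsub>G\<^esub> x) ` K = K"

definition num_classes_of_size :: "('a, 'b) monoid_scheme \<Rightarrow> nat \<Rightarrow> nat" where
  "num_classes_of_size G k = card {K \<in> conj_classes G. card K = k}"

definition num_real_classes_of_size :: "('a, 'b) monoid_scheme \<Rightarrow> nat \<Rightarrow> nat" where
  "num_real_classes_of_size G k = card {K \<in> conj_classes G. real_class G K \<and> card K = k}"

end

theory Submission
  imports Defs "Jordan_Normal_Form.Spectral_Radius" "Jordan_Normal_Form.Schur_Decomposition"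
    "HOL-Algebra.Multiplicative_Group"
begin

text \<open>Column orthogonality gives that \<open>\<Sum>\<^sub>\<chi> |\<chi>(x)|\<^sup>2\<close> is \<open>|G| / |K|\<close>, where \<open>K\<close> is the class of \<open>x\<close>, and that
  \<open>\<Sum>\<^sub>\<chi> \<chi>(x)\<^sup>2\<close> has the same value if \<open>x\<close> is conjugate to its inverse and is \<open>0\<close> otherwise. Expanding the
  sums over tuples, \<open>m\<^sub>n\<close> and \<open>r\<^sub>n\<close> are, up to the factor \<open>|G|\<close>, the \<open>n\<close>-th power sums of these
  quantities over \<open>x\<close>. Their nonzero values lie among the \<open>N\<close> numbers \<open>N / k\<close>, so the first \<open>N\<close> power sums
  determine how often each value occurs, that is \<open>k\<close> times the number of (real) classes of size \<open>k\<close>.\<close>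

subsection \<open>Traces and sums of matrices\<close>

text \<open>Column orthogonality depends on the irreducible characters spanning the class functions.
  Since \<open>Irr G\<close> is defined through matrix representations, three facts have to be
  established: \<open>Irr G\<close> is finite, so that sums over it do not collapse to the default
  value 0; its members are orthogonal; and a class function orthogonal to all of them is zero. The
  third is the real obstacle, and traces alone settle it. A functional that sums traces against
  fixed coefficients, if it vanishes on all irreducible representations, vanishes on every
  representation, in particular on the regular one, whose trace isolates the coefficient at the
  identity. Equality of traces stands in for isomorphism of representations throughout.\<close>

lemma mat_trace_mult_commute:
  assumes "A \<in> carrier_mat d e" and "B \<in> carrier_mat e d"
  shows "mat_trace (A * B) = mat_trace (B * A)"
proof -
  have "mat_trace (A * B) = (\<Sum>i<d. \<Sum>k<e. A $$ (i, k) * B $$ (k, i))"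
    using assms by (auto simp: mat_trace_def scalar_prod_def lessThan_atLeast0 intro!: sum.cong)
  also have "\<dots> = (\<Sum>k<e. \<Sum>i<d. B $$ (k, i) * A $$ (i, k))"
    by (subst sum.swap) (simp add: mult.commute)
  also have "\<dots> = mat_trace (B * A)"
    using assms by (auto simp: mat_trace_def scalar_prod_def lessThan_atLeast0 intro!: sum.cong)
  finally show ?thesis .
qed

lemma mat_trace_one [simp]: "mat_trace (1\<^sub>m d) = of_nat d"
  by (simp add: mat_trace_def)

lemma mat_trace_smult_one [simp]: "mat_trace (c \<cdot>\<^sub>m 1\<^sub>m d) = c * of_nat d"
  by (simp add: mat_trace_def)

text \<open>Cyclicity of the trace moves \<open>B\<close> to the other side, next to
  \<open>A\<close>. The shapes are rectangular because \<open>A\<close> will be an intertwiner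
  between representations whose degrees are not yet known to agree.\<close>

lemma mat_trace_conjugate:
  assumes "A \<in> carrier_mat d e" "B \<in> carrier_mat e d" "C \<in> carrier_mat e e"
    and "B * A = 1\<^sub>m e"
  shows "mat_trace (A * C * B) = mat_trace C"
proof -
  have "mat_trace (A * C * B) = mat_trace (A * (C * B))"
    using assms by (simp add: assoc_mult_mat[of _ d e _ e _ d])
  also have "\<dots> = mat_trace ((C * B) * A)"
    using assms by (intro mat_trace_mult_commute[of _ d e]) auto
  also have "(C * B) * A = C"
    using assms by (simp add: assoc_mult_mat[of _ e e _ d _ e])
  finally show ?thesis .
qed

text \<open>Matrices of all shapes share one type, so there is no single zero from which to start a
  sum; the explicit shape gives even the empty sum the right dimensions.\<close>

definition mat_sum :: "nat \<Rightarrow> nat \<Rightarrow> ('i \<Rightarrow> complex mat) \<Rightarrow> 'i set \<Rightarrow> complex mat" where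
  "mat_sum d e F I = mat d e (\<lambda>ij. \<Sum>x\<in>I. F x $$ ij)"

lemma mat_sum_carrier [simp]: "mat_sum d e F I \<in> carrier_mat d e"
  by (simp add: mat_sum_def)

lemma mat_sum_cong: "(\<And>x. x \<in> I \<Longrightarrow> F x = F' x) \<Longrightarrow> mat_sum d e F I = mat_sum d e F' I"
  by (auto simp: mat_sum_def intro!: cong_mat sum.cong)

lemma mat_sum_reindex:
  assumes "bij_betw h I J"
  shows "mat_sum d e (\<lambda>x. F (h x)) I = mat_sum d e F J"
  by (auto simp: mat_sum_def intro!: cong_mat sum.reindex_bij_betw[OF assms])

lemma mat_mult_sum:
  assumes "A \<in> carrier_mat c d" "\<And>x. x \<in> I \<Longrightarrow> F x \<in> carrier_mat d e"
  shows "A * mat_sum d e F I = mat_sum c e (\<lambda>x. A * F x) I"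
proof (rule eq_matI)
  fix i j assume "i < dim_row (mat_sum c e (\<lambda>x. A * F x) I)" "j < dim_col (mat_sum c e (\<lambda>x. A * F x) I)"
  then have ij: "i < c" "j < e" by (auto simp: mat_sum_def)
  have "(A * mat_sum d e F I) $$ (i, j) = (\<Sum>k<d. \<Sum>x\<in>I. A $$ (i, k) * F x $$ (k, j))"
    using assms ij by (auto simp: scalar_prod_def mat_sum_def lessThan_atLeast0 sum_distrib_left
      intro!: sum.cong)
  also have "\<dots> = (\<Sum>x\<in>I. \<Sum>k<d. A $$ (i, k) * F x $$ (k, j))"
    by (rule sum.swap)
  also have "\<dots> = (\<Sum>x\<in>I. (A * F x) $$ (i, j))"
  proof (rule sum.cong[OF refl])
    fix x assume "x \<in> I"
    with assms have "F x \<in> carrier_mat d e" by auto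
    with assms(1) ij show "(\<Sum>k<d. A $$ (i, k) * F x $$ (k, j)) = (A * F x) $$ (i, j)"
      by (auto simp: scalar_prod_def lessThan_atLeast0 intro!: sum.cong)
  qed
  finally show "(A * mat_sum d e F I) $$ (i, j) = mat_sum c e (\<lambda>x. A * F x) I $$ (i, j)"
    using ij by (simp add: mat_sum_def)
qed (use assms in \<open>auto simp: mat_sum_def\<close>)

lemma mat_sum_mult:
  assumes "A \<in> carrier_mat d e" "\<And>x. x \<in> I \<Longrightarrow> F x \<in> carrier_mat c d"
  shows "mat_sum c d F I * A = mat_sum c e (\<lambda>x. F x * A) I"
proof (rule eq_matI)
  fix i j assume "i < dim_row (mat_sum c e (\<lambda>x. F x * A) I)" "j < dim_col (mat_sum c e (\<lambda>x. F x * A) I)"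
  then have ij: "i < c" "j < e" by (auto simp: mat_sum_def)
  have "(mat_sum c d F I * A) $$ (i, j) = (\<Sum>k<d. \<Sum>x\<in>I. F x $$ (i, k) * A $$ (k, j))"
    using assms ij by (auto simp: scalar_prod_def mat_sum_def lessThan_atLeast0 sum_distrib_right
      intro!: sum.cong)
  also have "\<dots> = (\<Sum>x\<in>I. \<Sum>k<d. F x $$ (i, k) * A $$ (k, j))"
    by (rule sum.swap)
  also have "\<dots> = (\<Sum>x\<in>I. (F x * A) $$ (i, j))"
  proof (rule sum.cong[OF refl])
    fix x assume "x \<in> I"
    with assms have "F x \<in> carrier_mat c d" by auto
    with assms(1) ij show "(\<Sum>k<d. F x $$ (i, k) * A $$ (k, j)) = (F x * A) $$ (i, j)"
      by (auto simp: scalar_prod_def lessThan_atLeast0 intro!: sum.cong)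
  qed
  finally show "(mat_sum c d F I * A) $$ (i, j) = mat_sum c e (\<lambda>x. F x * A) I $$ (i, j)"
    using ij by (simp add: mat_sum_def)
qed (use assms in \<open>auto simp: mat_sum_def\<close>)

lemma mat_trace_mat_sum:
  assumes "\<And>x. x \<in> I \<Longrightarrow> F x \<in> carrier_mat d d"
  shows "mat_trace (mat_sum d d F I) = (\<Sum>x\<in>I. mat_trace (F x))"
proof -
  have "mat_trace (mat_sum d d F I) = (\<Sum>i<d. \<Sum>x\<in>I. F x $$ (i, i))"
    by (simp add: mat_trace_def mat_sum_def)
  also have "\<dots> = (\<Sum>x\<in>I. \<Sum>i<d. F x $$ (i, i))" by (rule sum.swap)
  also have "\<dots> = (\<Sum>x\<in>I. mat_trace (F x))"
    using assms by (intro sum.cong) (auto simp: mat_trace_def)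
  finally show ?thesis .
qed

lemma mat_eqI_vec:
  fixes A B :: "complex mat"
  assumes "A \<in> carrier_mat d e" "B \<in> carrier_mat d e"
    and eq: "\<And>v. v \<in> carrier_vec e \<Longrightarrow> A *\<^sub>v v = B *\<^sub>v v"
  shows "A = B"
proof (rule eq_matI)
  fix i j assume "i < dim_row B" "j < dim_col B"
  then have ij: "i < d" "j < e" using assms by auto
  have "A $$ (i, j) = (A *\<^sub>v unit_vec e j) $ i" "B $$ (i, j) = (B *\<^sub>v unit_vec e j) $ i"
    using assms(1,2) ij by (simp_all add: mult_mat_vec_def)
  then show "A $$ (i, j) = B $$ (i, j)" using eq[of "unit_vec e j"] by simp
qed (use assms in auto)

lemma mat_eq_zeroI:
  fixes A :: "complex mat"
  assumes "A \<in> carrier_mat d e" "\<And>v. v \<in> carrier_vec e \<Longrightarrow> A *\<^sub>v v = 0\<^sub>v d"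
  shows "A = 0\<^sub>m d e"
  by (rule mat_eqI_vec) (use assms in \<open>auto simp: scalar_prod_def\<close>)

text \<open>The middle factor is a matrix unit, so the product is column \<open>j\<close> of
  \<open>P\<close> times row \<open>k\<close> of \<open>Q\<close>.\<close>

lemma mat_unit_sandwich:
  fixes P Q :: "complex mat"
  assumes "P \<in> carrier_mat d d" "Q \<in> carrier_mat e e" "i < d" "j < d" "k < e" "l < e"
  shows "(P * mat d e (\<lambda>(a, b). if a = j \<and> b = k then 1 else 0) * Q) $$ (i, l)
    = P $$ (i, j) * Q $$ (k, l)"
proof -
  define X :: "complex mat" where "X = mat d e (\<lambda>(a, b). if a = j \<and> b = k then 1 else 0)"
  have PX: "(P * X) $$ (i, b) = (if b = k then P $$ (i, j) else 0)" if "b < e" for b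
  proof -
    have "(P * X) $$ (i, b) = (\<Sum>a<d. P $$ (i, a) * (if a = j \<and> b = k then 1 else 0))"
      using assms that by (simp add: scalar_prod_def X_def lessThan_atLeast0)
    also have "\<dots> = (\<Sum>a<d. if a = j then (if b = k then P $$ (i, j) else 0) else 0)"
      by (intro sum.cong) auto
    also have "\<dots> = (if b = k then P $$ (i, j) else 0)" using assms by simp
    finally show ?thesis .
  qed
  have "(P * X * Q) $$ (i, l) = (\<Sum>b<e. (P * X) $$ (i, b) * Q $$ (b, l))"
    using assms by (simp add: scalar_prod_def X_def lessThan_atLeast0)
  also have "\<dots> = (\<Sum>b<e. if b = k then P $$ (i, j) * Q $$ (k, l) else 0)"
    by (intro sum.cong) (auto simp: PX)
  finally show ?thesis using assms by (simp add: X_def)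
qed

text \<open>The bridge from characters to Schur's lemma: when \<open>P\<close> is a representation
  and \<open>Q x\<close> is the matrix of the inverse of \<open>x\<close>, the matrix sums on the
  right are intertwiners.\<close>

lemma mat_trace_mult_trace:
  assumes "\<And>x. x \<in> I \<Longrightarrow> P x \<in> carrier_mat d d" "\<And>x. x \<in> I \<Longrightarrow> Q x \<in> carrier_mat e e"
  shows "(\<Sum>x\<in>I. mat_trace (P x) * mat_trace (Q x)) = (\<Sum>i<d. \<Sum>k<e.
    mat_sum d e (\<lambda>x. P x * mat d e (\<lambda>(a, b). if a = i \<and> b = k then 1 else 0) * Q x) I $$ (i, k))"
proof -
  have "(\<Sum>x\<in>I. mat_trace (P x) * mat_trace (Q x))
    = (\<Sum>x\<in>I. \<Sum>i<d. \<Sum>k<e. P x $$ (i, i) * Q x $$ (k, k))"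
  proof (rule sum.cong[OF refl])
    fix x assume "x \<in> I"
    then have "P x \<in> carrier_mat d d" "Q x \<in> carrier_mat e e" using assms by auto
    then show "mat_trace (P x) * mat_trace (Q x) = (\<Sum>i<d. \<Sum>k<e. P x $$ (i, i) * Q x $$ (k, k))"
      by (auto simp: mat_trace_def sum_product)
  qed
  also have "\<dots> = (\<Sum>i<d. \<Sum>k<e. \<Sum>x\<in>I. P x $$ (i, i) * Q x $$ (k, k))"
    by (subst sum.swap, rule sum.cong[OF refl], rule sum.swap)
  also have "\<dots> = (\<Sum>i<d. \<Sum>k<e.
    mat_sum d e (\<lambda>x. P x * mat d e (\<lambda>(a, b). if a = i \<and> b = k then 1 else 0) * Q x) I $$ (i, k))"
    by (intro sum.cong refl) (auto simp: mat_sum_def simp del: index_mult_mat(1)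
      intro!: sum.cong mat_unit_sandwich[symmetric] assms)
  finally show ?thesis .
qed

section \<open>Traces of matrices of finite order\<close>

lemma upper_triangular_pow:
  fixes B :: "complex mat"
  assumes B: "B \<in> carrier_mat n n" "upper_triangular B"
  shows "upper_triangular (B ^\<^sub>m k) \<and> (\<forall>i<n. (B ^\<^sub>m k) $$ (i, i) = (B $$ (i, i)) ^ k)"
proof (induction k)
  case 0
  show ?case using B(1) by (auto simp: upper_triangular_def)
next
  case (Suc k)
  define C where "C = B ^\<^sub>m k"
  have C: "C \<in> carrier_mat n n" unfolding C_def using B(1) by (rule pow_carrier_mat)
  have Cz: "C $$ (i, j) = 0" if "j < i" "i < n" for i j
    using Suc C that by (auto simp: upper_triangular_def C_def[symmetric])
  have Bz: "B $$ (i, j) = 0" if "j < i" "i < n" for i j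
    using B that by (auto simp: upper_triangular_def)
  have e: "(C * B) $$ (i, j) = (\<Sum>l<n. C $$ (i, l) * B $$ (l, j))" if "i < n" "j < n" for i j
    using B(1) C that by (simp add: scalar_prod_def lessThan_atLeast0)
  have "(C * B) $$ (i, j) = 0" if "j < i" "i < n" for i j
  proof -
    have "C $$ (i, l) * B $$ (l, j) = 0" if "l < n" for l
      using Cz[of l i] Bz[of j l] \<open>j < i\<close> \<open>i < n\<close> that by (cases "l < i") auto
    then show ?thesis using that by (simp add: e del: mult_eq_0_iff)
  qed
  moreover have "(C * B) $$ (i, i) = C $$ (i, i) * B $$ (i, i)" if "i < n" for i
  proof -
    have "C $$ (i, l) * B $$ (l, i) = (if l = i then C $$ (i, i) * B $$ (i, i) else 0)" if "l < n" for l
      using Cz[of l i] Bz[of i l] \<open>i < n\<close> that by (cases "l < i"; cases "l = i") auto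
    then have "(C * B) $$ (i, i) = (\<Sum>l<n. if l = i then C $$ (i, i) * B $$ (i, i) else 0)"
      unfolding e[OF that that] by (intro sum.cong) auto
    then show ?thesis using that by simp
  qed
  ultimately show ?case
    using Suc B(1) C by (auto simp: upper_triangular_def C_def[symmetric])
qed

text \<open>The eigenvalues of a matrix of finite order are roots of unity, so inverting them is the
  same as conjugating them.\<close>

lemma mat_trace_finite_order:
  fixes A :: "complex mat"
  assumes A: "A \<in> carrier_mat d d" and pow: "A ^\<^sub>m Suc n = 1\<^sub>m d"
  shows "mat_trace (A ^\<^sub>m n) = cnj (mat_trace A)"
proof -
  obtain as where "char_poly A = (\<Prod>a\<leftarrow>as. [:- a, 1:])" using char_poly_factorized[OF A] by auto
  from schur_decomposition_exists[OF A this] obtain B P Q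
    where B: "B \<in> carrier_mat d d" "upper_triangular B" and wit: "similar_mat_wit A B P Q"
    by (auto simp: similar_mat_def)
  note PQ = similar_mat_witD2[OF A wit]
  have tr: "mat_trace (A ^\<^sub>m k) = (\<Sum>i<d. (B $$ (i, i)) ^ k)" for k
  proof -
    have "mat_trace (A ^\<^sub>m k) = mat_trace (B ^\<^sub>m k)"
      unfolding similar_mat_wit_pow_id[OF wit]
      by (rule mat_trace_conjugate) (use PQ pow_carrier_mat[OF B(1)] in auto)
    also have "\<dots> = (\<Sum>i<d. (B $$ (i, i)) ^ k)"
      using upper_triangular_pow[OF B, of k] pow_carrier_mat[OF B(1), of k]
      by (auto simp: mat_trace_def)
    finally show ?thesis .
  qed
  have "B ^\<^sub>m Suc n = 1\<^sub>m d"
  proof -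
    have "B ^\<^sub>m Suc n = Q * (A ^\<^sub>m Suc n) * P"
      by (rule similar_mat_wit_pow_id[OF similar_mat_wit_sym[OF wit]])
    then show ?thesis unfolding pow using PQ by simp
  qed
  then have one: "(B $$ (i, i)) ^ Suc n = 1" if "i < d" for i
    using upper_triangular_pow[OF B, of "Suc n"] that by (metis index_one_mat(1))
  have "(B $$ (i, i)) ^ n = cnj (B $$ (i, i))" if "i < d" for i
  proof -
    let ?b = "B $$ (i, i)"
    have "norm ?b ^ Suc n = 1" using one[OF that] by (metis norm_one norm_power)
    then have "norm ?b = 1" using power_eq_1_iff[of "norm ?b" "Suc n"] by auto
    then have "?b * cnj ?b = 1" by (simp add: complex_norm_square[symmetric])
    moreover have "?b * ?b ^ n = 1" using one[OF that] by simp
    ultimately have "?b * ?b ^ n = ?b * cnj ?b" and "?b \<noteq> 0" by auto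
    then show ?thesis by simp
  qed
  then show ?thesis using tr[of n] tr[of 1] A by simp
qed

subsection \<open>Schur's lemma\<close>

lemma is_rep_carrier: "is_rep G d \<rho> \<Longrightarrow> x \<in> carrier G \<Longrightarrow> \<rho> x \<in> carrier_mat d d"
  by (simp add: is_rep_def)

lemma is_rep_mult:
  "is_rep G d \<rho> \<Longrightarrow> x \<in> carrier G \<Longrightarrow> y \<in> carrier G \<Longrightarrow> \<rho> (x \<otimes>\<^bsub>G\<^esub> y) = \<rho> x * \<rho> y"
  by (simp add: is_rep_def)

lemma is_rep_one: "is_rep G d \<rho> \<Longrightarrow> \<rho> \<one>\<^bsub>G\<^esub> = 1\<^sub>m d"
  by (simp add: is_rep_def)

lemma irreducible_rep_is_rep: "irreducible_rep G d \<rho> \<Longrightarrow> is_rep G d \<rho>"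
  by (simp add: irreducible_rep_def)

lemma irreducible_rep_dim_pos: "irreducible_rep G d \<rho> \<Longrightarrow> d > 0"
  by (simp add: irreducible_rep_def)

lemma irreducible_rep_subspace:
  assumes "irreducible_rep G d \<rho>" "is_subspace d W"
    and "\<And>x w. x \<in> carrier G \<Longrightarrow> w \<in> W \<Longrightarrow> \<rho> x *\<^sub>v w \<in> W"
  shows "W = {0\<^sub>v d} \<or> W = carrier_vec d"
  using assms by (auto simp: irreducible_rep_def)

text \<open>The kernel of an intertwiner is invariant under \<open>\<sigma>\<close>, so one nonzero
  vector in it makes it the whole space. This yields injectivity of nonzero intertwiners and,
  applied to an eigenvector, the scalar form of Schur's lemma.\<close>

lemma intertwiner_kernel:
  assumes \<rho>: "is_rep G d \<rho>" and \<sigma>: "irreducible_rep G e \<sigma>"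
    and A: "A \<in> carrier_mat d e" "\<And>x. x \<in> carrier G \<Longrightarrow> \<rho> x * A = A * \<sigma> x"
    and v: "v \<in> carrier_vec e" "v \<noteq> 0\<^sub>v e" "A *\<^sub>v v = 0\<^sub>v d"
  shows "A = 0\<^sub>m d e"
proof -
  note \<sigma>r = irreducible_rep_is_rep[OF \<sigma>]
  define W where "W = {v \<in> carrier_vec e. A *\<^sub>v v = 0\<^sub>v d}"
  have "is_subspace e W"
    unfolding is_subspace_def W_def using A(1)
    by (auto simp: mult_add_distrib_mat_vec[OF A(1)] mult_mat_vec[OF A(1)] )
  moreover have "\<sigma> x *\<^sub>v w \<in> W" if x: "x \<in> carrier G" and w: "w \<in> W" for x w
  proof -
    have "A *\<^sub>v (\<sigma> x *\<^sub>v w) = (A * \<sigma> x) *\<^sub>v w"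
      using A(1) is_rep_carrier[OF \<sigma>r x] w by (auto simp: W_def)
    also have "\<dots> = \<rho> x *\<^sub>v (A *\<^sub>v w)"
      using A(1) is_rep_carrier[OF \<rho> x] w by (auto simp: W_def A(2)[OF x, symmetric])
    also have "\<dots> = 0\<^sub>v d" using w is_rep_carrier[OF \<rho> x] by (auto simp: W_def)
    finally show ?thesis using w is_rep_carrier[OF \<sigma>r x] by (auto simp: W_def)
  qed
  ultimately have "W = {0\<^sub>v e} \<or> W = carrier_vec e"
    by (rule irreducible_rep_subspace[OF \<sigma>])
  then have "W = carrier_vec e" using v by (auto simp: W_def)
  then show ?thesis using A(1) by (intro mat_eq_zeroI) (auto simp: W_def)
qed

text \<open>The image of \<open>A\<close> is invariant and nonzero, hence everything; preimages of
  the unit vectors are the columns of a right inverse \<open>B\<close>.\<close>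

lemma intertwiner_invertible:
  assumes \<rho>: "irreducible_rep G d \<rho>" and \<sigma>: "irreducible_rep G e \<sigma>"
    and A: "A \<in> carrier_mat d e" "\<And>x. x \<in> carrier G \<Longrightarrow> \<rho> x * A = A * \<sigma> x"
    and nz: "A \<noteq> 0\<^sub>m d e"
  obtains B where "B \<in> carrier_mat e d" "A * B = 1\<^sub>m d" "B * A = 1\<^sub>m e"
proof -
  note \<rho>r = irreducible_rep_is_rep[OF \<rho>] and \<sigma>r = irreducible_rep_is_rep[OF \<sigma>]
  define W where "W = {A *\<^sub>v v |v. v \<in> carrier_vec e}"
  have "is_subspace d W"
    unfolding is_subspace_def
  proof (intro conjI ballI allI)
    show "W \<subseteq> carrier_vec d" using A(1) by (auto simp: W_def)
    have "A *\<^sub>v 0\<^sub>v e = 0\<^sub>v d" using A(1) by auto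
    then show "0\<^sub>v d \<in> W" unfolding W_def by (metis (mono_tags, lifting) mem_Collect_eq zero_carrier_vec)
  next
    fix v w assume "v \<in> W" "w \<in> W"
    then obtain v' w' where "v' \<in> carrier_vec e" "w' \<in> carrier_vec e"
      "v = A *\<^sub>v v'" "w = A *\<^sub>v w'" by (auto simp: W_def)
    then show "v + w \<in> W" unfolding W_def
      by (auto intro!: exI[of _ "v' + w'"] simp: mult_add_distrib_mat_vec[OF A(1)])
  next
    fix c v assume "v \<in> W"
    then obtain v' where "v' \<in> carrier_vec e" "v = A *\<^sub>v v'" by (auto simp: W_def)
    then show "c \<cdot>\<^sub>v v \<in> W" unfolding W_def
      by (auto intro!: exI[of _ "c \<cdot>\<^sub>v v'"] simp: mult_mat_vec[OF A(1)])
  qed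
  moreover have "\<rho> x *\<^sub>v w \<in> W" if x: "x \<in> carrier G" and w: "w \<in> W" for x w
  proof -
    from w obtain v where v: "v \<in> carrier_vec e" "w = A *\<^sub>v v" by (auto simp: W_def)
    have "\<rho> x *\<^sub>v w = (\<rho> x * A) *\<^sub>v v" using v A(1) is_rep_carrier[OF \<rho>r x] by auto
    also have "\<dots> = A *\<^sub>v (\<sigma> x *\<^sub>v v)"
      using v A(1) is_rep_carrier[OF \<sigma>r x] by (auto simp: A(2)[OF x])
    finally show ?thesis using v is_rep_carrier[OF \<sigma>r x] by (auto simp: W_def)
  qed
  ultimately have "W = {0\<^sub>v d} \<or> W = carrier_vec d"
    by (rule irreducible_rep_subspace[OF \<rho>])
  moreover have "W \<noteq> {0\<^sub>v d}"
    using nz mat_eq_zeroI[OF A(1)] by (auto simp: W_def)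
  ultimately have W: "W = carrier_vec d" by blast
  have "\<forall>j. \<exists>v. j < d \<longrightarrow> v \<in> carrier_vec e \<and> A *\<^sub>v v = unit_vec d j"
  proof
    fix j
    have "unit_vec d j \<in> W" using W by simp
    then show "\<exists>v. j < d \<longrightarrow> v \<in> carrier_vec e \<and> A *\<^sub>v v = unit_vec d j"
      by (auto simp: W_def)
  qed
  then obtain b where b: "\<And>j. j < d \<Longrightarrow> b j \<in> carrier_vec e \<and> A *\<^sub>v b j = unit_vec d j"
    by metis
  define B where "B = mat e d (\<lambda>(i, j). b j $ i)"
  have B: "B \<in> carrier_mat e d" by (simp add: B_def)
  have colB: "col B j = b j" if "j < d" for j
    using b[OF that] that by (auto simp: B_def col_def)
  have AB: "A * B = 1\<^sub>m d"
  proof (rule eq_matI)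
    fix i j assume "i < dim_row (1\<^sub>m d)" "j < dim_col (1\<^sub>m d)"
    then have ij: "i < d" "j < d" by auto
    have "(A * B) $$ (i, j) = (A *\<^sub>v b j) $ i"
      using A(1) B ij by (simp add: colB)
    then show "(A * B) $$ (i, j) = 1\<^sub>m d $$ (i, j)" using b[OF ij(2)] ij by simp
  qed (use A(1) B in auto)
  have "B * A = 1\<^sub>m e"
  proof -
    have D: "B * A - 1\<^sub>m e \<in> carrier_mat e e" using A(1) B by auto
    have "(B * A - 1\<^sub>m e) *\<^sub>v v = 0\<^sub>v e" if v: "v \<in> carrier_vec e" for v
    proof (rule ccontr)
      assume nzv: "(B * A - 1\<^sub>m e) *\<^sub>v v \<noteq> 0\<^sub>v e"
      \<comment> \<open>\<open>A\<close> annihilates every value of \<open>B * A - 1\<close>, so a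
        nonzero value would be a kernel vector and would force \<open>A\<close> to be zero.\<close>
      have "A * (B * A - 1\<^sub>m e) = A * (B * A) - A * 1\<^sub>m e"
        by (rule mult_minus_distrib_mat[of _ d e _ e]) (use A(1) B in auto)
      also have "A * (B * A) = A * B * A" using A(1) B by (simp add: assoc_mult_mat[of _ d e _ d _ e])
      finally have "A * (B * A - 1\<^sub>m e) = 0\<^sub>m d e" using A(1) AB by simp
      then have "A *\<^sub>v ((B * A - 1\<^sub>m e) *\<^sub>v v) = 0\<^sub>v d"
        using v by (subst assoc_mult_mat_vec[OF A(1) D v, symmetric])
          (auto simp: scalar_prod_def)
      then show False
        using intertwiner_kernel[OF \<rho>r \<sigma> A _ nzv] D v nz by auto
    qed
    from mat_eq_zeroI[OF D this] have z: "B * A - 1\<^sub>m e = 0\<^sub>m e e" by simp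
    show ?thesis
    proof (rule eq_matI)
      fix i j assume ij: "i < dim_row (1\<^sub>m e)" "j < dim_col (1\<^sub>m e)"
      then have "(B * A - 1\<^sub>m e) $$ (i, j) = 0" by (simp add: z)
      moreover have "(B * A - 1\<^sub>m e) $$ (i, j) = (B * A) $$ (i, j) - 1\<^sub>m e $$ (i, j)"
        using ij A(1) B by (intro index_minus_mat) auto
      ultimately show "(B * A) $$ (i, j) = 1\<^sub>m e $$ (i, j)" by simp
    qed (use A(1) B in auto)
  qed
  with B AB that show thesis by blast
qed

text \<open>Used in contrapositive form: if two characters differ at a single point, the only
  intertwiner is zero.\<close>

lemma intertwiner_trace_eq:
  assumes \<rho>: "irreducible_rep G d \<rho>" and \<sigma>: "irreducible_rep G e \<sigma>"
    and A: "A \<in> carrier_mat d e" "\<And>x. x \<in> carrier G \<Longrightarrow> \<rho> x * A = A * \<sigma> x"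
    and nz: "A \<noteq> 0\<^sub>m d e" and x: "x \<in> carrier G"
  shows "mat_trace (\<rho> x) = mat_trace (\<sigma> x)"
proof -
  obtain B where B: "B \<in> carrier_mat e d" "A * B = 1\<^sub>m d" "B * A = 1\<^sub>m e"
    using intertwiner_invertible[OF \<rho> \<sigma> A nz] .
  note R = is_rep_carrier[OF irreducible_rep_is_rep[OF \<rho>] x]
    and S = is_rep_carrier[OF irreducible_rep_is_rep[OF \<sigma>] x]
  have "\<rho> x = \<rho> x * (A * B)" using R B by simp
  also have "\<dots> = \<rho> x * A * B" using R A(1) B(1) by (simp add: assoc_mult_mat[of _ d d _ e _ d])
  also have "\<dots> = A * \<sigma> x * B" by (simp add: A(2)[OF x])
  finally show ?thesis using mat_trace_conjugate[OF A(1) B(1) S B(3)] by simp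
qed

text \<open>A complex matrix of positive size has an eigenvalue \<open>c\<close>; then
  \<open>A - c\<close> still commutes with the representation and kills an eigenvector, hence
  vanishes.\<close>

lemma schur_scalar:
  assumes \<rho>: "irreducible_rep G d \<rho>"
    and A: "A \<in> carrier_mat d d" "\<And>x. x \<in> carrier G \<Longrightarrow> \<rho> x * A = A * \<rho> x"
  obtains c where "A = c \<cdot>\<^sub>m 1\<^sub>m d"
proof -
  note \<rho>r = irreducible_rep_is_rep[OF \<rho>]
  from spectrum_non_empty[OF A(1) irreducible_rep_dim_pos[OF \<rho>]]
  obtain c v where v: "v \<in> carrier_vec d" "v \<noteq> 0\<^sub>v d" "A *\<^sub>v v = c \<cdot>\<^sub>v v"
    using A(1) by (auto simp: spectrum_def eigenvalue_def eigenvector_def)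
  define B where "B = A - c \<cdot>\<^sub>m 1\<^sub>m d"
  have B: "B \<in> carrier_mat d d" using A(1) by (simp add: B_def minus_carrier_mat)
  have "\<rho> x * B = B * \<rho> x" if x: "x \<in> carrier G" for x
  proof -
    note R = is_rep_carrier[OF \<rho>r x]
    have "\<rho> x * B = \<rho> x * A - \<rho> x * (c \<cdot>\<^sub>m 1\<^sub>m d)"
      unfolding B_def by (rule mult_minus_distrib_mat[of _ d d _ d]) (use R A(1) in auto)
    also have "\<rho> x * (c \<cdot>\<^sub>m 1\<^sub>m d) = c \<cdot>\<^sub>m 1\<^sub>m d * \<rho> x"
      using R by (simp add: mult_smult_distrib[OF R one_carrier_mat] mult_smult_assoc_mat[of _ d d _ d])
    also have "\<rho> x * A - c \<cdot>\<^sub>m 1\<^sub>m d * \<rho> x = B * \<rho> x"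
      unfolding B_def A(2)[OF x] by (rule minus_mult_distrib_mat[symmetric, of _ d d _ _ d]) (use R A(1) in auto)
    finally show ?thesis .
  qed
  moreover have "B *\<^sub>v v = 0\<^sub>v d"
  proof -
    have "B *\<^sub>v v = A *\<^sub>v v - (c \<cdot>\<^sub>m 1\<^sub>m d) *\<^sub>v v"
      unfolding B_def by (rule minus_mult_distrib_mat_vec[of _ d d]) (use A(1) v in auto)
    also have "(c \<cdot>\<^sub>m 1\<^sub>m d) *\<^sub>v v = c \<cdot>\<^sub>v v"
      using v by (auto simp: scalar_prod_def if_distrib if_distribR cong: if_cong)
    finally show ?thesis using v by simp
  qed
  ultimately have B0: "B = 0\<^sub>m d d"
    using intertwiner_kernel[OF \<rho>r \<rho> B _ v(1,2)] by blast
  have "A = c \<cdot>\<^sub>m 1\<^sub>m d"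
  proof (rule eq_matI)
    fix i j assume ij: "i < dim_row (c \<cdot>\<^sub>m 1\<^sub>m d)" "j < dim_col (c \<cdot>\<^sub>m 1\<^sub>m d)"
    then have "B $$ (i, j) = 0" by (simp add: B0)
    then show "A $$ (i, j) = (c \<cdot>\<^sub>m 1\<^sub>m d) $$ (i, j)"
      using ij A(1) by (simp add: B_def)
  qed (use A(1) in auto)
  then show thesis by (rule that)
qed

subsection \<open>Row orthogonality\<close>

context group
begin

lemma bij_betw_mult_left: "a \<in> carrier G \<Longrightarrow> bij_betw (\<lambda>x. a \<otimes> x) (carrier G) (carrier G)"
  by (rule bij_betw_byWitness[of _ "\<lambda>x. inv a \<otimes> x"]) (auto simp: m_assoc[symmetric])

text \<open>Each summand satisfies \<open>\<rho> y * F x = F (y \<otimes> x) * \<sigma> y\<close>,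
  and left translation by \<open>y\<close> permutes the carrier.\<close>

lemma average_intertwines:
  assumes \<rho>: "is_rep G d \<rho>" and \<sigma>: "is_rep G e \<sigma>" and X: "X \<in> carrier_mat d e"
    and y: "y \<in> carrier G"
  defines "A \<equiv> mat_sum d e (\<lambda>x. \<rho> x * X * \<sigma> (inv x)) (carrier G)"
  shows "\<rho> y * A = A * \<sigma> y"
proof -
  define F where "F = (\<lambda>x. \<rho> x * X * \<sigma> (inv x))"
  note R = is_rep_carrier[OF \<rho>] and S = is_rep_carrier[OF \<sigma>]
  have F: "F x \<in> carrier_mat d e" if "x \<in> carrier G" for x
    unfolding F_def by (rule mult_carrier_mat[OF mult_carrier_mat[OF R X] S]) (use that in auto)
  have eq: "\<rho> y * F x = F (y \<otimes> x) * \<sigma> y" if x: "x \<in> carrier G" for x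
  proof -
    have i: "inv (y \<otimes> x) \<otimes> y = inv x" using x y by (simp add: inv_mult_group m_assoc)
    have "F (y \<otimes> x) * \<sigma> y = \<rho> (y \<otimes> x) * X * (\<sigma> (inv (y \<otimes> x)) * \<sigma> y)"
      unfolding F_def using R[of "y \<otimes> x"] S[of "inv (y \<otimes> x)"] S[OF y] x y X
      by (intro assoc_mult_mat[of _ d e _ e _ e]) auto
    also have "\<sigma> (inv (y \<otimes> x)) * \<sigma> y = \<sigma> (inv x)"
      using is_rep_mult[OF \<sigma>, of "inv (y \<otimes> x)" y] i x y by simp
    also have "\<rho> (y \<otimes> x) * X * \<sigma> (inv x) = \<rho> y * F x"
      unfolding F_def is_rep_mult[OF \<rho> y x]
      using R[OF y] R[OF x] S[of "inv x"] x X
      by (simp add: assoc_mult_mat[of _ d d _ d _ e] assoc_mult_mat[of _ d d _ e _ e])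
    finally show ?thesis by simp
  qed
  have "\<rho> y * A = mat_sum d e (\<lambda>x. \<rho> y * F x) (carrier G)"
    unfolding A_def F_def[symmetric] using F R[OF y] by (intro mat_mult_sum) auto
  also have "\<dots> = mat_sum d e (\<lambda>x. F (y \<otimes> x) * \<sigma> y) (carrier G)"
    by (intro mat_sum_cong eq)
  also have "\<dots> = mat_sum d e (\<lambda>x. F x * \<sigma> y) (carrier G)"
    by (rule mat_sum_reindex[OF bij_betw_mult_left[OF y], of _ _ "\<lambda>x. F x * \<sigma> y"])
  also have "\<dots> = A * \<sigma> y"
    unfolding A_def F_def[symmetric] using F S[OF y] by (intro mat_sum_mult[symmetric]) auto
  finally show ?thesis .
qed

text \<open>The averages of the matrix units are intertwiners, which the differing traces force to
  be zero; the sum of trace products adds up entries of these averages.\<close>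

lemma trace_orthogonal:
  assumes \<rho>: "irreducible_rep G d \<rho>" and \<sigma>: "irreducible_rep G e \<sigma>"
    and y: "y \<in> carrier G" "mat_trace (\<rho> y) \<noteq> mat_trace (\<sigma> y)"
  shows "(\<Sum>x\<in>carrier G. mat_trace (\<rho> x) * mat_trace (\<sigma> (inv x))) = 0"
proof -
  note \<rho>r = irreducible_rep_is_rep[OF \<rho>] and \<sigma>r = irreducible_rep_is_rep[OF \<sigma>]
  have z: "mat_sum d e (\<lambda>x. \<rho> x * X * \<sigma> (inv x)) (carrier G) = 0\<^sub>m d e"
    if X: "X \<in> carrier_mat d e" for X
    using intertwiner_trace_eq[OF \<rho> \<sigma> mat_sum_carrier average_intertwines[OF \<rho>r \<sigma>r X] _ y(1)] y(2)
    by blast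
  show ?thesis
    by (subst mat_trace_mult_trace[of _ _ d _ e])
      (auto simp: z is_rep_carrier[OF \<rho>r] is_rep_carrier[OF \<sigma>r])
qed

text \<open>By Schur's lemma the average of a matrix unit is a scalar matrix. Its trace is the group
  order times the trace of the matrix unit, so the scalar is the order over \<open>d\<close> for a
  diagonal unit, and the \<open>d\<close> diagonal units contribute the order in total.\<close>

lemma trace_normalized:
  assumes \<rho>: "irreducible_rep G d \<rho>"
  shows "(\<Sum>x\<in>carrier G. mat_trace (\<rho> x) * mat_trace (\<rho> (inv x))) = of_nat (card (carrier G))"
proof -
  note \<rho>r = irreducible_rep_is_rep[OF \<rho>]
  note R = is_rep_carrier[OF \<rho>r]
  have d: "d > 0" using irreducible_rep_dim_pos[OF \<rho>] .
  define E :: "nat \<Rightarrow> nat \<Rightarrow> complex mat"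
    where "E = (\<lambda>i k. mat d d (\<lambda>(a, b). if a = i \<and> b = k then 1 else 0))"
  define A where "A = (\<lambda>X. mat_sum d d (\<lambda>x. \<rho> x * X * \<rho> (inv x)) (carrier G))"
  have entry: "A (E i k) $$ (i, k) = (if i = k then of_nat (card (carrier G)) / of_nat d else 0)"
    if ik: "i < d" "k < d" for i k
  proof -
    have E: "E i k \<in> carrier_mat d d" by (simp add: E_def)
    obtain c where c: "A (E i k) = c \<cdot>\<^sub>m 1\<^sub>m d"
      unfolding A_def using schur_scalar[OF \<rho> mat_sum_carrier average_intertwines[OF \<rho>r \<rho>r E]] .
    have "mat_trace (A (E i k)) = (\<Sum>x\<in>carrier G. mat_trace (\<rho> x * E i k * \<rho> (inv x)))"
      unfolding A_def
      by (rule mat_trace_mat_sum, rule mult_carrier_mat[OF mult_carrier_mat[OF R E] R]) auto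
    also have "\<dots> = (\<Sum>x\<in>carrier G. mat_trace (E i k))"
    proof (rule sum.cong[OF refl], rule mat_trace_conjugate[of _ d d])
      fix x assume x: "x \<in> carrier G"
      show "\<rho> (inv x) * \<rho> x = 1\<^sub>m d"
        using is_rep_mult[OF \<rho>r, of "inv x" x] is_rep_one[OF \<rho>r] x by simp
    qed (use R E in auto)
    also have "\<dots> = of_nat (card (carrier G)) * (if i = k then 1 else 0)"
    proof -
      have "mat_trace (E i k) = (\<Sum>a<d. if a = i then (if i = k then 1 else 0) else 0)"
        unfolding mat_trace_def E_def by (auto intro!: sum.cong)
      then show ?thesis using ik by simp
    qed
    finally have "c * of_nat d = of_nat (card (carrier G)) * (if i = k then 1 else 0)"
      using c by simp
    then show ?thesis using c ik d by (auto simp: field_simps)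
  qed
  have "(\<Sum>x\<in>carrier G. mat_trace (\<rho> x) * mat_trace (\<rho> (inv x))) = (\<Sum>i<d. \<Sum>k<d. A (E i k) $$ (i, k))"
    unfolding A_def E_def by (rule mat_trace_mult_trace) (use R in auto)
  also have "\<dots> = (\<Sum>i<d. \<Sum>k<d. if i = k then of_nat (card (carrier G)) / of_nat d else 0)"
    by (intro sum.cong) (auto simp: entry)
  also have "\<dots> = of_nat (card (carrier G))" using d by simp
  finally show ?thesis .
qed


text \<open>With group order \<open>Suc n\<close>, the power \<open>x [^] n\<close> is the inverse
  of \<open>x\<close> and the matrix of \<open>x\<close> has finite order. This turns the inverses
  of the Schur averages into the complex conjugates of the inner product.\<close>

lemma trace_inv_cnj:
  assumes fin: "finite (carrier G)" and \<rho>: "is_rep G d \<rho>" and x: "x \<in> carrier G"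
  shows "mat_trace (\<rho> (inv x)) = cnj (mat_trace (\<rho> x))"
proof -
  have pow: "\<rho> (x [^] (k::nat)) = \<rho> x ^\<^sub>m k" for k
    by (induction k) (use is_rep_one[OF \<rho>] is_rep_mult[OF \<rho> _ x] is_rep_carrier[OF \<rho> x] x in auto)
  obtain n where n: "card (carrier G) = Suc n" 
    using fin one_closed by (cases "card (carrier G)") auto
  have e: "x [^] Suc n = \<one>" using pow_order_eq_1[OF x] n by (simp add: Coset.order_def)
  then have "x [^] n = inv x" using x by (simp add: inv_equality)
  moreover have "\<rho> x ^\<^sub>m Suc n = 1\<^sub>m d" using pow[of "Suc n"] e is_rep_one[OF \<rho>] by simp
  ultimately show ?thesis
    using mat_trace_finite_order[OF is_rep_carrier[OF \<rho> x]] pow[of n] by simp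
qed

end

subsection \<open>Irreducible constituents\<close>

text \<open>The exchange matrix of Steinitz: multiplying a basis matrix by it on the right replaces
  the basis vector number \<open>i\<close> by the vector with coordinates \<open>v\<close>.\<close>

definition replace_col_mat :: "nat \<Rightarrow> nat \<Rightarrow> complex vec \<Rightarrow> complex mat" where
  "replace_col_mat d i v = mat d d (\<lambda>(a, b). if b = i then v $ a else if a = b then 1 else 0)"

lemma replace_col_mat_carrier [simp]: "replace_col_mat d i v \<in> carrier_mat d d"
  by (simp add: replace_col_mat_def)

lemma replace_col_mat_mult_vec:
  assumes "i < d" "u \<in> carrier_vec d" "a < d"
  shows "(replace_col_mat d i v *\<^sub>v u) $ a = (if a = i then 0 else u $ a) + u $ i * v $ a"
proof -
  have "(replace_col_mat d i v *\<^sub>v u) $ a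
      = (\<Sum>b<d. (if b = i then v $ a else if a = b then 1 else 0) * u $ b)"
    using assms by (simp add: replace_col_mat_def scalar_prod_def lessThan_atLeast0)
  also have "\<dots> = (\<Sum>b<d. (if b = a then (if a = i then 0 else u $ a) else 0)
      + (if b = i then u $ i * v $ a else 0))"
    by (intro sum.cong) auto
  also have "\<dots> = (if a = i then 0 else u $ a) + u $ i * v $ a"
    using assms by (simp add: sum.distrib)
  finally show ?thesis .
qed

lemma replace_col_mat_inverse:
  assumes i: "i < d" and v: "v \<in> carrier_vec d" "v $ i \<noteq> 0"
  obtains M where "M \<in> carrier_mat d d" "replace_col_mat d i v * M = 1\<^sub>m d"
proof
  \<comment> \<open>The inverse has the same shape. Its column solves
    \<open>v' $ i * v $ i = 1\<close> and, for the other indices,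
    \<open>v' $ a + v' $ i * v $ a = 0\<close>.\<close>
  define v' where "v' = vec d (\<lambda>a. if a = i then 1 / v $ i else - v $ a / v $ i)"
  define M where "M = replace_col_mat d i v'"
  show M: "M \<in> carrier_mat d d" by (simp add: M_def)
  show "replace_col_mat d i v * M = 1\<^sub>m d"
  proof (rule mat_eqI_vec[of _ d d])
    fix u :: "complex vec" assume u: "u \<in> carrier_vec d"
    have Mu: "M *\<^sub>v u \<in> carrier_vec d" using M u by simp
    have "replace_col_mat d i v * M *\<^sub>v u = replace_col_mat d i v *\<^sub>v (M *\<^sub>v u)"
      using M u by (intro assoc_mult_mat_vec[of _ d d]) auto
    also have "\<dots> = u"
    proof (rule eq_vecI)
      fix a assume "a < dim_vec u"
      then have a: "a < d" using u by simp
      show "(replace_col_mat d i v *\<^sub>v (M *\<^sub>v u)) $ a = u $ a"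
        unfolding replace_col_mat_mult_vec[OF i Mu a]
        using a i v u by (auto simp: M_def replace_col_mat_mult_vec[OF i u] v'_def field_simps
          simp del: index_mult_mat_vec)
    qed (use u in \<open>auto simp: replace_col_mat_def\<close>)
    finally show "replace_col_mat d i v * M *\<^sub>v u = 1\<^sub>m d *\<^sub>v u" using u by simp
  qed (use M replace_col_mat_carrier in \<open>auto intro!: mult_carrier_mat\<close>)
qed

text \<open>The columns of \<open>P\<close> form a basis of the whole space, those indexed by
  \<open>S\<close> form a basis of \<open>W\<close>, and \<open>Q\<close> reads off coordinates.
  Such a basis arises by taking \<open>S\<close> maximal among the index sets whose columns lie in
  \<open>W\<close>: a vector of \<open>W\<close> with a nonzero coordinate outside \<open>S\<close>
  could be exchanged in.\<close>

lemma subspace_adapted_basis: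
  assumes W: "is_subspace d W"
  obtains P Q S where "P \<in> carrier_mat d d" "Q \<in> carrier_mat d d" "P * Q = 1\<^sub>m d" "Q * P = 1\<^sub>m d"
    "S \<subseteq> {..<d}"
    "\<forall>u\<in>carrier_vec d. (\<forall>i<d. i \<notin> S \<longrightarrow> u $ i = 0) \<longrightarrow> P *\<^sub>v u \<in> W"
    "\<forall>w\<in>W. \<forall>i<d. i \<notin> S \<longrightarrow> (Q *\<^sub>v w) $ i = 0"
proof -
  have sub: "W \<subseteq> carrier_vec d" "0\<^sub>v d \<in> W"
    and add: "\<And>v w. v \<in> W \<Longrightarrow> w \<in> W \<Longrightarrow> v + w \<in> W"
    and smult: "\<And>c v. v \<in> W \<Longrightarrow> c \<cdot>\<^sub>v v \<in> W"
    using W by (auto simp: is_subspace_def)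
  define good where "good = (\<lambda>S P Q. P \<in> carrier_mat d d \<and> Q \<in> carrier_mat d d \<and> P * Q = 1\<^sub>m d \<and>
    S \<subseteq> {..<d} \<and> (\<forall>u\<in>carrier_vec d. (\<forall>i<d. i \<notin> S \<longrightarrow> u $ i = 0) \<longrightarrow> P *\<^sub>v u \<in> W))"
  have fin: "finite {S. \<exists>P Q. good S P Q}"
    by (rule finite_subset[of _ "Pow {..<d}"]) (auto simp: good_def)
  have "good {} (1\<^sub>m d) (1\<^sub>m d)"
    unfolding good_def
  proof (intro conjI ballI impI)
    fix u :: "complex vec" assume u: "u \<in> carrier_vec d" "\<forall>i<d. i \<notin> {} \<longrightarrow> u $ i = 0"
    then have "u = 0\<^sub>v d" by (intro eq_vecI) auto
    then show "1\<^sub>m d *\<^sub>v u \<in> W" using sub by simp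
  qed auto
  then have ne: "{S. \<exists>P Q. good S P Q} \<noteq> {}" by blast
  obtain S where "S \<in> {S. \<exists>P Q. good S P Q}"
    and maximal: "\<forall>S'\<in>{S. \<exists>P Q. good S P Q}. S \<subseteq> S' \<longrightarrow> S = S'"
    using finite_has_maximal[OF fin ne] by blast
  then obtain P Q where good: "good S P Q" by blast
  then have P: "P \<in> carrier_mat d d" and Q: "Q \<in> carrier_mat d d" and PQ: "P * Q = 1\<^sub>m d"
    and S: "S \<subseteq> {..<d}"
    and PW: "\<forall>u\<in>carrier_vec d. (\<forall>i<d. i \<notin> S \<longrightarrow> u $ i = 0) \<longrightarrow> P *\<^sub>v u \<in> W"
    by (auto simp: good_def)
  have QW: "(Q *\<^sub>v w) $ i = 0" if w: "w \<in> W" and i: "i < d" "i \<notin> S" for w i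
  proof (rule ccontr)
    assume nz: "(Q *\<^sub>v w) $ i \<noteq> 0"
    define v where "v = Q *\<^sub>v w"
    have wc: "w \<in> carrier_vec d" using w sub by blast
    have v: "v \<in> carrier_vec d" using Q wc by (simp add: v_def)
    have Pv: "P *\<^sub>v v = w"
      unfolding v_def using assoc_mult_mat_vec[OF P Q wc] PQ wc by simp
    \<comment> \<open>Passing from \<open>P\<close> to \<open>P * E\<close> swaps column
      \<open>i\<close> for \<open>w\<close>; the nonzero coordinate \<open>v $ i\<close> keeps the
      new matrix invertible.\<close>
    define E where "E = replace_col_mat d i v"
    have E: "E \<in> carrier_mat d d" by (simp add: E_def)
    obtain M where M: "M \<in> carrier_mat d d" "E * M = 1\<^sub>m d"
      using replace_col_mat_inverse[OF i(1) v] nz unfolding v_def[symmetric] E_def by blast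
    have "good (insert i S) (P * E) (M * Q)"
      unfolding good_def
    proof (intro conjI ballI impI)
      have "P * E * (M * Q) = P * (E * M) * Q"
        using P E M(1) Q by (simp add: assoc_mult_mat[of _ d d _ d _ d] mult_carrier_mat[of _ d d])
      then show "P * E * (M * Q) = 1\<^sub>m d" using M(2) P PQ by simp
    next
      fix u :: "complex vec"
      assume u: "u \<in> carrier_vec d" "\<forall>j<d. j \<notin> insert i S \<longrightarrow> u $ j = 0"
      define u0 where "u0 = vec d (\<lambda>a. if a = i then 0 else u $ a)"
      have u0: "u0 \<in> carrier_vec d" by (simp add: u0_def)
      have "E *\<^sub>v u = u0 + u $ i \<cdot>\<^sub>v v"
      proof (rule eq_vecI)
        fix a assume "a < dim_vec (u0 + u $ i \<cdot>\<^sub>v v)"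
        then have a: "a < d" using v by simp
        show "(E *\<^sub>v u) $ a = (u0 + u $ i \<cdot>\<^sub>v v) $ a"
          unfolding E_def replace_col_mat_mult_vec[OF i(1) u(1) a] using a v by (simp add: u0_def)
      qed (use v E in auto)
      then have "P * E *\<^sub>v u = P *\<^sub>v u0 + u $ i \<cdot>\<^sub>v w"
        using assoc_mult_mat_vec[OF P E u(1)] mult_add_distrib_mat_vec[OF P u0, of "u $ i \<cdot>\<^sub>v v"]
          mult_mat_vec[OF P v] v Pv by simp
      moreover have "P *\<^sub>v u0 \<in> W" using u u0 by (intro PW[rule_format]) (auto simp: u0_def)
      ultimately show "P * E *\<^sub>v u \<in> W" using add smult w by simp
    qed (use P E M Q S i in auto)
    then have "insert i S \<in> {S. \<exists>P Q. good S P Q}" by blast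
    then have "S = insert i S" using maximal by blast
    then show False using i by blast
  qed
  then show thesis
    by (intro that[OF P Q PQ mat_mult_left_right_inverse[OF P Q PQ] S PW]) auto
qed

text \<open>The diagonal block on \<open>T\<close> is multiplicative if no product of entries leaves
  \<open>T\<close> and comes back. Stating this for products lets one lemma cover both the
  subrepresentation and the quotient of a block triangular representation.\<close>

lemma is_rep_compress:
  assumes \<rho>: "is_rep G d \<rho>" and T: "T \<subseteq> {..<d}"
    and zero: "\<And>x y i j k. x \<in> carrier G \<Longrightarrow> y \<in> carrier G \<Longrightarrow> i \<in> T \<Longrightarrow> j \<in> T \<Longrightarrow> k < d \<Longrightarrow> k \<notin> T \<Longrightarrow>
      \<rho> x $$ (i, k) * \<rho> y $$ (k, j) = 0"
  obtains \<sigma> where "is_rep G (card T) \<sigma>"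
    "\<forall>x\<in>carrier G. mat_trace (\<sigma> x) = (\<Sum>i\<in>T. \<rho> x $$ (i, i))"
proof -
  have finT: "finite T" using T finite_subset by blast
  obtain e where e: "bij_betw e {..<card T} T"
    using ex_bij_betw_nat_finite[OF finT] by (auto simp: lessThan_atLeast0)
  have eT: "e a \<in> T" if "a < card T" for a using e that by (auto simp: bij_betw_def)
  then have ed: "e a < d" if "a < card T" for a using T that by blast
  define \<sigma> where "\<sigma> = (\<lambda>x. mat (card T) (card T) (\<lambda>(a, b). \<rho> x $$ (e a, e b)))"
  note R = is_rep_carrier[OF \<rho>]
  have "is_rep G (card T) \<sigma>"
    unfolding is_rep_def
  proof (intro conjI ballI)
    have "e a = e b \<longleftrightarrow> a = b" if "a < card T" "b < card T" for a b
      using e that by (auto simp: bij_betw_def inj_on_def)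
    then show "\<sigma> \<one>\<^bsub>G\<^esub> = 1\<^sub>m (card T)"
      using ed by (auto simp: \<sigma>_def is_rep_one[OF \<rho>] )
  next
    fix x y assume x: "x \<in> carrier G" and y: "y \<in> carrier G"
    show "\<sigma> (x \<otimes>\<^bsub>G\<^esub> y) = \<sigma> x * \<sigma> y"
    proof (rule eq_matI)
      fix a b assume "a < dim_row (\<sigma> x * \<sigma> y)" "b < dim_col (\<sigma> x * \<sigma> y)"
      then have ab: "a < card T" "b < card T" by (auto simp: \<sigma>_def)
      have "\<sigma> (x \<otimes>\<^bsub>G\<^esub> y) $$ (a, b) = (\<rho> x * \<rho> y) $$ (e a, e b)"
        using ab by (simp add: \<sigma>_def is_rep_mult[OF \<rho> x y])
      also have "\<dots> = (\<Sum>k<d. \<rho> x $$ (e a, k) * \<rho> y $$ (k, e b))"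
        using R[OF x] R[OF y] ed ab by (simp add: scalar_prod_def lessThan_atLeast0)
      also have "\<dots> = (\<Sum>k\<in>T. \<rho> x $$ (e a, k) * \<rho> y $$ (k, e b))"
        using T zero[OF x y] eT ab by (intro sum.mono_neutral_right) auto
      also have "\<dots> = (\<Sum>c<card T. \<rho> x $$ (e a, e c) * \<rho> y $$ (e c, e b))"
        by (rule sum.reindex_bij_betw[OF e, symmetric])
      also have "\<dots> = (\<sigma> x * \<sigma> y) $$ (a, b)"
        using ab by (simp add: \<sigma>_def scalar_prod_def lessThan_atLeast0)
      finally show "\<sigma> (x \<otimes>\<^bsub>G\<^esub> y) $$ (a, b) = (\<sigma> x * \<sigma> y) $$ (a, b)" .
    qed (auto simp: \<sigma>_def)
  qed (auto simp: \<sigma>_def)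
  moreover have "mat_trace (\<sigma> x) = (\<Sum>i\<in>T. \<rho> x $$ (i, i))" for x
    unfolding sum.reindex_bij_betw[OF e, symmetric] by (simp add: mat_trace_def \<sigma>_def)
  ultimately show thesis using that by blast
qed

section \<open>Splitting a trace along an invariant subspace\<close>

context group
begin

lemma is_rep_similar:
  assumes \<rho>: "is_rep G d \<rho>" and P: "P \<in> carrier_mat d d" and Q: "Q \<in> carrier_mat d d"
    and PQ: "P * Q = 1\<^sub>m d" "Q * P = 1\<^sub>m d"
  shows "is_rep G d (\<lambda>x. Q * \<rho> x * P)"
  unfolding is_rep_def
proof (intro conjI ballI)
  note R = is_rep_carrier[OF \<rho>]
  show "Q * \<rho> x * P \<in> carrier_mat d d" if "x \<in> carrier G" for x
    using P Q R[OF that] by auto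
  show "Q * \<rho> \<one> * P = 1\<^sub>m d" using P Q PQ by (simp add: is_rep_one[OF \<rho>])
  fix x y assume x: "x \<in> carrier G" and y: "y \<in> carrier G"
  have "Q * \<rho> x * P * (Q * \<rho> y * P) = Q * \<rho> x * (P * Q) * \<rho> y * P"
    using P Q R[OF x] R[OF y]
    by (simp add: assoc_mult_mat[of _ d d _ d _ d] mult_carrier_mat[of _ d d])
  also have "\<dots> = Q * (\<rho> x * \<rho> y) * P"
    using P Q R[OF x] R[OF y] PQ
    by (simp add: assoc_mult_mat[of _ d d _ d _ d] mult_carrier_mat[of _ d d])
  finally show "Q * \<rho> (x \<otimes> y) * P = Q * \<rho> x * P * (Q * \<rho> y * P)"
    by (simp add: is_rep_mult[OF \<rho> x y])
qed

text \<open>In a basis adapted to an invariant subspace all matrices are block triangular. The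
  diagonal blocks are the subrepresentation and the quotient, both of smaller degree because the
  subspace is nonzero and proper.\<close>

lemma reducible_rep_split:
  assumes \<rho>: "is_rep G d \<rho>" and d: "d > 0" and red: "\<not> irreducible_rep G d \<rho>"
  obtains d1 d2 \<rho>1 \<rho>2 where "d1 < d" "d2 < d" "is_rep G d1 \<rho>1" "is_rep G d2 \<rho>2"
    "\<forall>x\<in>carrier G. mat_trace (\<rho> x) = mat_trace (\<rho>1 x) + mat_trace (\<rho>2 x)"
proof -
  note R = is_rep_carrier[OF \<rho>]
  obtain W where W: "is_subspace d W" "W \<noteq> {0\<^sub>v d}" "W \<noteq> carrier_vec d"
    and inv: "\<And>x w. x \<in> carrier G \<Longrightarrow> w \<in> W \<Longrightarrow> \<rho> x *\<^sub>v w \<in> W"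
    using red \<rho> d by (auto simp: irreducible_rep_def)
  have sub: "W \<subseteq> carrier_vec d" "0\<^sub>v d \<in> W" using W(1) by (auto simp: is_subspace_def)
  obtain P Q S where P: "P \<in> carrier_mat d d" and Q: "Q \<in> carrier_mat d d"
    and PQ: "P * Q = 1\<^sub>m d" "Q * P = 1\<^sub>m d" and S: "S \<subseteq> {..<d}"
    and PW: "\<forall>u\<in>carrier_vec d. (\<forall>i<d. i \<notin> S \<longrightarrow> u $ i = 0) \<longrightarrow> P *\<^sub>v u \<in> W"
    and QW: "\<forall>w\<in>W. \<forall>i<d. i \<notin> S \<longrightarrow> (Q *\<^sub>v w) $ i = 0"
    using subspace_adapted_basis[OF W(1)] .
  have finS: "finite S" using S finite_subset by blast
  have PQv: "P *\<^sub>v (Q *\<^sub>v v) = v" if "v \<in> carrier_vec d" for v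
    using assoc_mult_mat_vec[OF P Q that] PQ that by simp
  have "S \<noteq> {}"
  proof
    assume "S = {}"
    have "w = 0\<^sub>v d" if "w \<in> W" for w
    proof -
      have "Q *\<^sub>v w = 0\<^sub>v d" using QW[rule_format, OF that] \<open>S = {}\<close> Q by (intro eq_vecI) auto
      moreover have "P *\<^sub>v 0\<^sub>v d = 0\<^sub>v d" using P by (auto simp: scalar_prod_def)
      ultimately show ?thesis using PQv[of w] that sub by (metis subsetD)
    qed
    then show False using W(2) sub by blast
  qed
  have "S \<noteq> {..<d}"
  proof
    assume "S = {..<d}"
    then have "P *\<^sub>v (Q *\<^sub>v v) \<in> W" if "v \<in> carrier_vec d" for v
      using Q that by (intro PW[rule_format]) auto
    then show False using PQv W(3) sub by auto
  qed
  define \<tau> where "\<tau> = (\<lambda>x. Q * \<rho> x * P)"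
  have \<tau>: "is_rep G d \<tau>" unfolding \<tau>_def by (rule is_rep_similar[OF \<rho> P Q PQ])
  \<comment> \<open>Column \<open>j\<close> of \<open>\<tau> x\<close> holds the coordinates of the
    image of a basis vector of \<open>W\<close>, which stays in \<open>W\<close>.\<close>
  have zero: "\<tau> x $$ (i, j) = 0" if x: "x \<in> carrier G" and i: "i < d" "i \<notin> S" and j: "j \<in> S" for x i j
  proof -
    have jd: "j < d" using j S by blast
    have "P *\<^sub>v unit_vec d j \<in> W" using j by (intro PW[rule_format]) (auto simp: unit_vec_def)
    from inv[OF x this] have "(Q *\<^sub>v (\<rho> x *\<^sub>v (P *\<^sub>v unit_vec d j))) $ i = 0"
      using i by (intro QW[rule_format]) auto
    also have "Q *\<^sub>v (\<rho> x *\<^sub>v (P *\<^sub>v unit_vec d j)) = \<tau> x *\<^sub>v unit_vec d j"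
      unfolding \<tau>_def using P Q R[OF x]
      by (simp add: assoc_mult_mat_vec[of _ d d _ d] mult_carrier_mat[of _ d d] mult_mat_vec_carrier[of _ d d])
    also have "(\<tau> x *\<^sub>v unit_vec d j) $ i = \<tau> x $$ (i, j)"
      using is_rep_carrier[OF \<tau> x] i jd by (simp add: mult_mat_vec_def)
    finally show ?thesis .
  qed
  obtain \<sigma>1 where \<sigma>1: "is_rep G (card S) \<sigma>1"
    "\<forall>x\<in>carrier G. mat_trace (\<sigma>1 x) = (\<Sum>i\<in>S. \<tau> x $$ (i, i))"
    by (rule is_rep_compress[OF \<tau> S]) (auto simp: zero)
  obtain \<sigma>2 where \<sigma>2: "is_rep G (card ({..<d} - S)) \<sigma>2"
    "\<forall>x\<in>carrier G. mat_trace (\<sigma>2 x) = (\<Sum>i\<in>{..<d} - S. \<tau> x $$ (i, i))"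
    by (rule is_rep_compress[OF \<tau>, of "{..<d} - S"]) (auto simp: zero)
  have "card S < d"
    using psubset_card_mono[of "{..<d}" S] S \<open>S \<noteq> {..<d}\<close> by auto
  moreover have "card ({..<d} - S) < d"
    using psubset_card_mono[of "{..<d}" "{..<d} - S"] S \<open>S \<noteq> {}\<close> by auto
  moreover have "mat_trace (\<rho> x) = mat_trace (\<sigma>1 x) + mat_trace (\<sigma>2 x)" if x: "x \<in> carrier G" for x
  proof -
    have "mat_trace (\<rho> x) = mat_trace (\<tau> x)"
      unfolding \<tau>_def by (rule mat_trace_conjugate[symmetric, OF Q P R[OF x] PQ(1)])
    also have "\<dots> = (\<Sum>i<d. \<tau> x $$ (i, i))"
      using is_rep_carrier[OF \<tau> x] by (simp add: mat_trace_def)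
    also have "\<dots> = mat_trace (\<sigma>1 x) + mat_trace (\<sigma>2 x)"
      unfolding \<sigma>1(2)[rule_format, OF x] \<sigma>2(2)[rule_format, OF x] using sum.subset_diff[OF S] by (simp add: add.commute)
    finally show ?thesis .
  qed
  ultimately show thesis by (intro that[OF _ _ \<sigma>1(1) \<sigma>2(1)] ballI)
qed

text \<open>This replaces complete reducibility: a trace splits along any invariant subspace, with or
  without an invariant complement.\<close>

lemma irreducible_constituent:
  assumes "is_rep G d \<rho>" and "(\<Sum>x\<in>carrier G. b x * mat_trace (\<rho> x)) \<noteq> 0"
  shows "\<exists>e \<sigma>. irreducible_rep G e \<sigma> \<and> (\<Sum>x\<in>carrier G. b x * mat_trace (\<sigma> x)) \<noteq> 0"
  using assms
proof (induction d arbitrary: \<rho> rule: less_induct)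
  case (less d)
  show ?case
  proof (cases "irreducible_rep G d \<rho>")
    case True
    with less.prems show ?thesis by blast
  next
    case False
    \<comment> \<open>A representation of degree 0 is neither irreducible nor splittable, but its
      trace is an empty sum, so the functional would vanish on it.\<close>
    have "d > 0"
    proof (rule ccontr)
      assume "\<not> d > 0"
      then have "mat_trace (\<rho> x) = 0" if "x \<in> carrier G" for x
        using is_rep_carrier[OF less.prems(1) that] by (auto simp: mat_trace_def)
      then show False using less.prems(2) by simp
    qed
    obtain d1 d2 \<rho>1 \<rho>2
      where lt: "d1 < d" "d2 < d" and reps: "is_rep G d1 \<rho>1" "is_rep G d2 \<rho>2"
      and tr: "\<forall>x\<in>carrier G. mat_trace (\<rho> x) = mat_trace (\<rho>1 x) + mat_trace (\<rho>2 x)"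
      using reducible_rep_split[OF less.prems(1) \<open>d > 0\<close> False] .
    have "(\<Sum>x\<in>carrier G. b x * mat_trace (\<rho> x))
      = (\<Sum>x\<in>carrier G. b x * mat_trace (\<rho>1 x)) + (\<Sum>x\<in>carrier G. b x * mat_trace (\<rho>2 x))"
      by (simp add: tr distrib_left sum.distrib)
    with less.prems(2) have "(\<Sum>x\<in>carrier G. b x * mat_trace (\<rho>1 x)) \<noteq> 0 \<or>
      (\<Sum>x\<in>carrier G. b x * mat_trace (\<rho>2 x)) \<noteq> 0" by auto
    then show ?thesis using less.IH[OF lt(1) reps(1)] less.IH[OF lt(2) reps(2)] by blast
  qed
qed

text \<open>The trace of a permutation matrix counts fixed points, and left translation by
  \<open>x\<close> has none unless \<open>x\<close> is the identity. The enumeration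
  \<open>f\<close> turns group elements into matrix indices.\<close>

lemma regular_rep:
  assumes fin: "finite (carrier G)"
  obtains \<rho> where "is_rep G (card (carrier G)) \<rho>"
    "\<And>x. x \<in> carrier G \<Longrightarrow> mat_trace (\<rho> x) = (if x = \<one> then of_nat (card (carrier G)) else 0)"
proof -
  define N where "N = card (carrier G)"
  obtain f where f: "bij_betw f {..<N} (carrier G)"
    using ex_bij_betw_nat_finite[OF fin] by (auto simp: lessThan_atLeast0 N_def)
  have fc: "f i \<in> carrier G" if "i < N" for i using f that by (auto simp: bij_betw_def)
  have fi: "f i = f j \<longleftrightarrow> i = j" if "i < N" "j < N" for i j
    using f that by (auto simp: bij_betw_def inj_on_def)
  define \<rho> :: "'a \<Rightarrow> complex mat"
    where "\<rho> = (\<lambda>x. mat N N (\<lambda>(i, j). if f i = x \<otimes> f j then 1 else 0))"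
  have "is_rep G N \<rho>"
    unfolding is_rep_def
  proof (intro conjI ballI)
    show "\<rho> \<one> = 1\<^sub>m N" using fc fi by (auto simp: \<rho>_def)
    fix x y assume x: "x \<in> carrier G" and y: "y \<in> carrier G"
    show "\<rho> (x \<otimes> y) = \<rho> x * \<rho> y"
    proof (rule eq_matI)
      fix i j assume "i < dim_row (\<rho> x * \<rho> y)" "j < dim_col (\<rho> x * \<rho> y)"
      then have ij: "i < N" "j < N" by (auto simp: \<rho>_def)
      have "(\<rho> x * \<rho> y) $$ (i, j) = (\<Sum>k<N. (if f i = x \<otimes> f k then 1 else 0) * (if f k = y \<otimes> f j then 1 else 0))"
        using ij by (simp add: \<rho>_def scalar_prod_def lessThan_atLeast0)
      also have "\<dots> = (\<Sum>g\<in>carrier G. (if f i = x \<otimes> g then 1 else 0) * (if g = y \<otimes> f j then 1 else 0))"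
        by (rule sum.reindex_bij_betw[OF f])
      also have "\<dots> = (\<Sum>g\<in>carrier G. if g = y \<otimes> f j then (if f i = x \<otimes> (y \<otimes> f j) then 1 else 0) else 0)"
        by (intro sum.cong) auto
      also have "\<dots> = (if f i = x \<otimes> (y \<otimes> f j) then 1 else 0)"
        using fin y fc[OF ij(2)] by simp
      also have "\<dots> = \<rho> (x \<otimes> y) $$ (i, j)"
        using ij x y fc by (simp add: \<rho>_def m_assoc)
      finally show "\<rho> (x \<otimes> y) $$ (i, j) = (\<rho> x * \<rho> y) $$ (i, j)" by simp
    qed (auto simp: \<rho>_def)
  qed (auto simp: \<rho>_def)
  moreover have "mat_trace (\<rho> x) = (if x = \<one> then of_nat N else 0)" if x: "x \<in> carrier G" for x
  proof -
    have "f i = x \<otimes> f i \<longleftrightarrow> x = \<one>" if "i < N" for i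
      using fc[OF that] x by (metis l_one one_closed right_cancel)
    then show ?thesis by (auto simp: mat_trace_def \<rho>_def)
  qed
  ultimately show thesis using that unfolding N_def by blast
qed

end

subsection \<open>Column orthogonality\<close>

context group
begin

section \<open>Irreducible characters as class functions\<close>

lemma inv_mult_cancel_left: "x \<in> carrier G \<Longrightarrow> y \<in> carrier G \<Longrightarrow> inv x \<otimes> (x \<otimes> y) = y"
  by (simp flip: m_assoc)

lemma mult_inv_cancel_left: "x \<in> carrier G \<Longrightarrow> y \<in> carrier G \<Longrightarrow> x \<otimes> (inv x \<otimes> y) = y"
  by (simp flip: m_assoc)

lemma IrrE:
  assumes "\<chi> \<in> Irr G"
  obtains d \<rho> where "irreducible_rep G d \<rho>" "\<And>x. x \<in> carrier G \<Longrightarrow> \<chi> x = mat_trace (\<rho> x)"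
  using assms by (auto simp: Irr_def)

lemma IrrI: "irreducible_rep G d \<rho> \<Longrightarrow> (\<lambda>x\<in>carrier G. mat_trace (\<rho> x)) \<in> Irr G"
  by (auto simp: Irr_def)

lemma Irr_inv:
  assumes "finite (carrier G)" "\<chi> \<in> Irr G" "x \<in> carrier G"
  shows "\<chi> (inv x) = cnj (\<chi> x)"
  using assms(2)
proof (rule IrrE)
  fix d \<rho> assume "irreducible_rep G d \<rho>" and eq: "\<And>x. x \<in> carrier G \<Longrightarrow> \<chi> x = mat_trace (\<rho> x)"
  then show ?thesis
    using trace_inv_cnj[OF assms(1) irreducible_rep_is_rep assms(3)] assms(3) by simp
qed

lemma Irr_conj_eq:
  assumes "\<chi> \<in> Irr G" "x \<in> carrier G" "g \<in> carrier G"
  shows "\<chi> (g \<otimes> x \<otimes> inv g) = \<chi> x"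
  using assms(1)
proof (rule IrrE)
  fix d \<rho> assume irr: "irreducible_rep G d \<rho>"
    and eq: "\<And>x. x \<in> carrier G \<Longrightarrow> \<chi> x = mat_trace (\<rho> x)"
  note \<rho> = irreducible_rep_is_rep[OF irr]
  note R = is_rep_carrier[OF \<rho>]
  have one: "\<rho> (inv g) * \<rho> g = 1\<^sub>m d"
    using is_rep_mult[OF \<rho>, of "inv g" g] is_rep_one[OF \<rho>] assms by simp
  have "\<rho> (g \<otimes> x \<otimes> inv g) = \<rho> g * \<rho> x * \<rho> (inv g)"
    using assms by (simp add: is_rep_mult[OF \<rho>])
  then have "mat_trace (\<rho> (g \<otimes> x \<otimes> inv g)) = mat_trace (\<rho> x)"
    using mat_trace_conjugate[OF R R R one] assms by simp
  then show ?thesis using eq assms by simp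
qed

lemma Irr_one:
  assumes "\<chi> \<in> Irr G"
  obtains d where "d > 0" "\<chi> \<one> = of_nat d"
  using assms
proof (rule IrrE)
  fix d \<rho> assume irr: "irreducible_rep G d \<rho>"
    and eq: "\<And>x. x \<in> carrier G \<Longrightarrow> \<chi> x = mat_trace (\<rho> x)"
  then show thesis
    using that[of d] irreducible_rep_dim_pos[OF irr] is_rep_one[OF irreducible_rep_is_rep[OF irr]]
    by simp
qed

text \<open>Members of \<open>Irr G\<close> are \<open>undefined\<close> off the carrier, so two
  that agree on the group are one element of the set and are summed over only once.\<close>

lemma Irr_eqI:
  assumes "\<chi> \<in> Irr G" "\<psi> \<in> Irr G" "\<And>x. x \<in> carrier G \<Longrightarrow> \<chi> x = \<psi> x"
  shows "\<chi> = \<psi>"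
proof
  fix x
  show "\<chi> x = \<psi> x" using assms by (cases "x \<in> carrier G") (auto simp: Irr_def)
qed

lemma Irr_orthonormal:
  assumes fin: "finite (carrier G)" and \<chi>: "\<chi> \<in> Irr G" and \<psi>: "\<psi> \<in> Irr G"
  shows "(\<Sum>x\<in>carrier G. \<chi> x * cnj (\<psi> x)) = (if \<chi> = \<psi> then of_nat (card (carrier G)) else 0)"
proof -
  obtain d \<rho> where \<rho>: "irreducible_rep G d \<rho>" "\<And>x. x \<in> carrier G \<Longrightarrow> \<chi> x = mat_trace (\<rho> x)"
    using IrrE[OF \<chi>] by blast
  obtain e \<sigma> where \<sigma>: "irreducible_rep G e \<sigma>" "\<And>x. x \<in> carrier G \<Longrightarrow> \<psi> x = mat_trace (\<sigma> x)"
    using IrrE[OF \<psi>] by blast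
  have "(\<Sum>x\<in>carrier G. \<chi> x * cnj (\<psi> x)) = (\<Sum>x\<in>carrier G. \<chi> x * \<psi> (inv x))"
    by (simp add: Irr_inv[OF fin \<psi>])
  also have "\<dots> = (if \<chi> = \<psi> then of_nat (card (carrier G)) else 0)"
  proof (cases "\<chi> = \<psi>")
    \<comment> \<open>\<open>\<rho>\<close> and \<open>\<sigma>\<close> may be different
      representations with the same character; here both factors are evaluated through
      \<open>\<rho>\<close>.\<close>
    case True
    have "(\<Sum>x\<in>carrier G. \<chi> x * \<psi> (inv x))
      = (\<Sum>x\<in>carrier G. mat_trace (\<rho> x) * mat_trace (\<rho> (inv x)))"
      unfolding True[symmetric] by (intro sum.cong) (auto simp: \<rho>(2))
    then show ?thesis using trace_normalized[OF \<rho>(1)] True by simp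
  next
    case False
    then obtain y where "y \<in> carrier G" "\<chi> y \<noteq> \<psi> y" using Irr_eqI[OF \<chi> \<psi>] by blast
    then have "(\<Sum>x\<in>carrier G. mat_trace (\<rho> x) * mat_trace (\<sigma> (inv x))) = 0"
      using \<rho>(2) \<sigma>(2) by (intro trace_orthogonal[OF \<rho>(1) \<sigma>(1)]) auto
    moreover have "(\<Sum>x\<in>carrier G. \<chi> x * \<psi> (inv x))
      = (\<Sum>x\<in>carrier G. mat_trace (\<rho> x) * mat_trace (\<sigma> (inv x)))"
      by (intro sum.cong) (auto simp: \<rho>(2) \<sigma>(2))
    ultimately show ?thesis using False by simp
  qed
  finally show ?thesis .
qed

text \<open>For a finite set of irreducible characters, compare the value at the identity of
  the sum of all \<open>\<chi>(1) \<chi>\<close> with its \<open>L\<^sup>2\<close>-norm.\<close>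

lemma card_Irr_subset_le:
  assumes fin: "finite (carrier G)" and F: "finite F" "F \<subseteq> Irr G"
  shows "card F \<le> card (carrier G)"
proof -
  define N where "N = card (carrier G)"
  have "\<forall>\<chi>\<in>F. \<exists>d. d > 0 \<and> \<chi> \<one> = of_nat d" using Irr_one F(2) by blast
  then obtain deg where deg: "\<And>\<chi>. \<chi> \<in> F \<Longrightarrow> deg \<chi> > (0::nat)" "\<And>\<chi>. \<chi> \<in> F \<Longrightarrow> \<chi> \<one> = of_nat (deg \<chi>)"
    by metis
  define D where "D = (\<Sum>\<chi>\<in>F. (deg \<chi>)\<^sup>2)"
  define s where "s = (\<lambda>x. \<Sum>\<chi>\<in>F. of_nat (deg \<chi>) * \<chi> x)"
  have s1: "s \<one> = of_nat D"
    unfolding s_def D_def of_nat_sum by (intro sum.cong) (auto simp: deg power2_eq_square)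
  have "(\<Sum>x\<in>carrier G. s x * cnj (s x)) = (\<Sum>x\<in>carrier G. \<Sum>\<chi>\<in>F. \<Sum>\<psi>\<in>F.
      of_nat (deg \<chi>) * of_nat (deg \<psi>) * (\<chi> x * cnj (\<psi> x)))"
    by (auto simp: s_def sum_product mult_ac intro!: sum.cong)
  also have "\<dots> = (\<Sum>\<chi>\<in>F. \<Sum>\<psi>\<in>F. \<Sum>x\<in>carrier G.
      of_nat (deg \<chi>) * of_nat (deg \<psi>) * (\<chi> x * cnj (\<psi> x)))"
    by (subst sum.swap, rule sum.cong[OF refl], rule sum.swap)
  also have "\<dots> = (\<Sum>\<chi>\<in>F. \<Sum>\<psi>\<in>F. of_nat (deg \<chi>) * of_nat (deg \<psi>) *
      (if \<chi> = \<psi> then of_nat N else 0))"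
    unfolding sum_distrib_left[symmetric] N_def
    using F(2) by (intro sum.cong refl) (auto simp: Irr_orthonormal[OF fin] subset_iff)
  also have "\<dots> = (\<Sum>\<chi>\<in>F. \<Sum>\<psi>\<in>F. if \<psi> = \<chi> then of_nat (deg \<chi>) * of_nat (deg \<chi>) * of_nat N else 0)"
    by (intro sum.cong) auto
  also have "\<dots> = of_nat (D * N)"
    using F(1) by (simp add: D_def power2_eq_square sum_distrib_right)
  finally have "complex_of_real (\<Sum>x\<in>carrier G. (cmod (s x))\<^sup>2) = complex_of_real (real (D * N))"
    by (simp add: complex_norm_square del: of_real_power)
  then have sq: "(\<Sum>x\<in>carrier G. (cmod (s x))\<^sup>2) = real (D * N)"
    using of_real_eq_iff by blast
  \<comment> \<open>The term at the identity alone is the square of \<open>D\<close>, while the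
    whole sum is \<open>D * N\<close>; hence \<open>D\<close> is at most \<open>N\<close>.\<close>
  have "(cmod (s \<one>))\<^sup>2 \<le> (\<Sum>x\<in>carrier G. (cmod (s x))\<^sup>2)"
    using fin by (intro member_le_sum) auto
  then have "real (D * D) \<le> real (D * N)" unfolding sq s1 by (simp add: power2_eq_square)
  then have "D \<le> N" by (cases "D = 0") auto
  moreover have "card F \<le> D"
  proof -
    have "card F = (\<Sum>\<chi>\<in>F. 1)" by simp
    also have "\<dots> \<le> D" unfolding D_def
      using deg(1) by (intro sum_mono) (simp add: Suc_leI)
    finally show ?thesis .
  qed
  ultimately show ?thesis by (simp add: N_def)
qed

text \<open>A uniform bound on finite subsets bounds the set itself. Finiteness gives meaning to the
  sums over characters and over tuples of characters, which would be 0 by convention on an infinite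
  index set.\<close>

lemma finite_Irr:
  assumes "finite (carrier G)"
  shows "finite (Irr G)"
proof (rule ccontr)
  assume "infinite (Irr G)"
  then obtain F where "finite F" "card F = Suc (card (carrier G))" "F \<subseteq> Irr G"
    using infinite_arbitrarily_large by blast
  then show False using card_Irr_subset_le[OF assms, of F] by simp
qed

text \<open>Conjugation permutes the summands of a class function, so the matrix commutes with the
  representation and is scalar; its trace is the given sum, which forces the scalar to be 0.\<close>

lemma class_function_sum_eq_zero:
  assumes irr: "irreducible_rep G d \<rho>"
    and inv_conj: "\<And>x h. x \<in> carrier G \<Longrightarrow> h \<in> carrier G \<Longrightarrow> g (h \<otimes> x \<otimes> inv h) = g x"
    and orth: "(\<Sum>x\<in>carrier G. g x * mat_trace (\<rho> (inv x))) = 0"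
  shows "mat_sum d d (\<lambda>x. g x \<cdot>\<^sub>m \<rho> (inv x)) (carrier G) = 0\<^sub>m d d"
proof -
  note \<rho> = irreducible_rep_is_rep[OF irr]
  note R = is_rep_carrier[OF \<rho>]
  define A where "A = mat_sum d d (\<lambda>x. g x \<cdot>\<^sub>m \<rho> (inv x)) (carrier G)"
  have A: "A \<in> carrier_mat d d" by (simp add: A_def)
  have "\<rho> y * A = A * \<rho> y" if y: "y \<in> carrier G" for y
  proof -
    have bij: "bij_betw (\<lambda>x. y \<otimes> x \<otimes> inv y) (carrier G) (carrier G)"
      by (rule bij_betw_byWitness[of _ "\<lambda>x. inv y \<otimes> x \<otimes> y"])
        (use y in \<open>auto simp: m_assoc inv_mult_cancel_left mult_inv_cancel_left\<close>)
    have "\<rho> y * A = mat_sum d d (\<lambda>x. \<rho> y * (g x \<cdot>\<^sub>m \<rho> (inv x))) (carrier G)"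
      unfolding A_def using R y by (intro mat_mult_sum) auto
    also have "\<dots> = mat_sum d d (\<lambda>x. g (y \<otimes> x \<otimes> inv y) \<cdot>\<^sub>m \<rho> (inv (y \<otimes> x \<otimes> inv y)) * \<rho> y) (carrier G)"
    proof (rule mat_sum_cong)
      fix x assume x: "x \<in> carrier G"
      have i: "inv (y \<otimes> x \<otimes> inv y) \<otimes> y = y \<otimes> inv x"
        using x y by (simp add: inv_mult_group m_assoc)
      have "\<rho> y * (g x \<cdot>\<^sub>m \<rho> (inv x)) = g x \<cdot>\<^sub>m (\<rho> y * \<rho> (inv x))"
        using R x y by (intro mult_smult_distrib) auto
      also have "\<rho> y * \<rho> (inv x) = \<rho> (inv (y \<otimes> x \<otimes> inv y)) * \<rho> y"
        using is_rep_mult[OF \<rho>, of y "inv x"] is_rep_mult[OF \<rho>, of "inv (y \<otimes> x \<otimes> inv y)" y] i x y by simp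
      also have "g x \<cdot>\<^sub>m (\<rho> (inv (y \<otimes> x \<otimes> inv y)) * \<rho> y) = g x \<cdot>\<^sub>m \<rho> (inv (y \<otimes> x \<otimes> inv y)) * \<rho> y"
        using R x y by (intro mult_smult_assoc_mat[symmetric, of _ d d _ d]) auto
      finally show "\<rho> y * (g x \<cdot>\<^sub>m \<rho> (inv x))
        = g (y \<otimes> x \<otimes> inv y) \<cdot>\<^sub>m \<rho> (inv (y \<otimes> x \<otimes> inv y)) * \<rho> y"
        using inv_conj[OF x y] by simp
    qed
    also have "\<dots> = mat_sum d d (\<lambda>x. g x \<cdot>\<^sub>m \<rho> (inv x) * \<rho> y) (carrier G)"
      by (rule mat_sum_reindex[OF bij, of _ _ "\<lambda>x. g x \<cdot>\<^sub>m \<rho> (inv x) * \<rho> y"])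
    also have "\<dots> = A * \<rho> y"
      unfolding A_def using R y by (intro mat_sum_mult[symmetric]) auto
    finally show ?thesis .
  qed
  then obtain c where c: "A = c \<cdot>\<^sub>m 1\<^sub>m d" using schur_scalar[OF irr A] by blast
  have "mat_trace A = (\<Sum>x\<in>carrier G. mat_trace (g x \<cdot>\<^sub>m \<rho> (inv x)))"
    unfolding A_def using R by (intro mat_trace_mat_sum) auto
  also have "\<dots> = (\<Sum>x\<in>carrier G. g x * mat_trace (\<rho> (inv x)))"
  proof (rule sum.cong[OF refl])
    fix x assume "x \<in> carrier G"
    then have "\<rho> (inv x) \<in> carrier_mat d d" using R by auto
    then show "mat_trace (g x \<cdot>\<^sub>m \<rho> (inv x)) = g x * mat_trace (\<rho> (inv x))"
      by (auto simp: mat_trace_def sum_distrib_left)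
  qed
  finally have "c = 0" using orth c irreducible_rep_dim_pos[OF irr] by simp
  then show ?thesis using c unfolding A_def by auto
qed

text \<open>If \<open>g\<close> is orthogonal to all irreducible characters, then \<open>g\<close> and hence \<open>g\<^sup>* g\<close> acts as zero in every
  irreducible representation, so the trace of \<open>g\<^sup>* g\<close> on the group algebra vanishes. That trace
  is the square of the norm of \<open>g\<close>, up to a factor.\<close>

lemma class_function_eq_zero:
  assumes fin: "finite (carrier G)"
    and inv_conj: "\<And>x h. x \<in> carrier G \<Longrightarrow> h \<in> carrier G \<Longrightarrow> g (h \<otimes> x \<otimes> inv h) = g x"
    and orth: "\<And>\<chi>. \<chi> \<in> Irr G \<Longrightarrow> (\<Sum>x\<in>carrier G. g x * cnj (\<chi> x)) = 0"
    and x: "x \<in> carrier G"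
  shows "g x = 0"
proof -
  \<comment> \<open>The autocorrelation of \<open>g\<close>: the sum of all \<open>b z\<close> times
    \<open>\<rho> z\<close> factors as the sum of \<open>g x\<close> times
    \<open>\<rho> (inv x)\<close> followed by the sum of \<open>cnj (g y)\<close> times
    \<open>\<rho> y\<close>. At the identity, \<open>b\<close> is the sum of the squared moduli of
    \<open>g\<close>.\<close>
  define b where "b = (\<lambda>z. \<Sum>x\<in>carrier G. g x * cnj (g (x \<otimes> z)))"
  have vanish: "(\<Sum>z\<in>carrier G. b z * mat_trace (\<rho> z)) = 0" if irr: "irreducible_rep G d \<rho>" for d \<rho>
  proof -
    note \<rho> = irreducible_rep_is_rep[OF irr]
    note R = is_rep_carrier[OF \<rho>]
    have "(\<Sum>x\<in>carrier G. g x * mat_trace (\<rho> (inv x))) = 0"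
      using orth[OF IrrI[OF irr]] by (simp add: trace_inv_cnj[OF fin \<rho>])
    from class_function_sum_eq_zero[OF irr inv_conj this]
    have A: "mat_sum d d (\<lambda>x. g x \<cdot>\<^sub>m \<rho> (inv x)) (carrier G) = 0\<^sub>m d d" by blast
    have inner: "(\<Sum>x\<in>carrier G. g x * mat_trace (\<rho> (inv x \<otimes> y))) = 0" if y: "y \<in> carrier G" for y
    proof -
      have "(\<Sum>x\<in>carrier G. g x * mat_trace (\<rho> (inv x \<otimes> y)))
          = (\<Sum>x\<in>carrier G. mat_trace (g x \<cdot>\<^sub>m \<rho> (inv x) * \<rho> y))"
      proof (rule sum.cong[OF refl])
        fix x assume x: "x \<in> carrier G"
        then have Rx: "\<rho> (inv x) \<in> carrier_mat d d" using R by auto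
        have "g x \<cdot>\<^sub>m \<rho> (inv x) * \<rho> y = g x \<cdot>\<^sub>m \<rho> (inv x \<otimes> y)"
          using mult_smult_assoc_mat[OF Rx R[OF y]] is_rep_mult[OF \<rho> _ y, of "inv x"] x by simp
        moreover have "\<rho> (inv x \<otimes> y) \<in> carrier_mat d d" using R x y by auto
        ultimately show "g x * mat_trace (\<rho> (inv x \<otimes> y)) = mat_trace (g x \<cdot>\<^sub>m \<rho> (inv x) * \<rho> y)"
          by (auto simp: mat_trace_def sum_distrib_left)
      qed
      also have "\<dots> = mat_trace (mat_sum d d (\<lambda>x. g x \<cdot>\<^sub>m \<rho> (inv x) * \<rho> y) (carrier G))"
        using R y by (intro mat_trace_mat_sum[symmetric] mult_carrier_mat[of _ d d]) auto
      also have "mat_sum d d (\<lambda>x. g x \<cdot>\<^sub>m \<rho> (inv x) * \<rho> y) (carrier G) = 0\<^sub>m d d * \<rho> y"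
        unfolding A[symmetric] using R y by (intro mat_sum_mult[symmetric]) auto
      also have "mat_trace (0\<^sub>m d d * \<rho> y) = 0"
        using R[OF y] by (simp add: mat_trace_def)
      finally show ?thesis .
    qed
    have "(\<Sum>z\<in>carrier G. b z * mat_trace (\<rho> z))
        = (\<Sum>x\<in>carrier G. \<Sum>z\<in>carrier G. g x * cnj (g (x \<otimes> z)) * mat_trace (\<rho> z))"
      unfolding b_def sum_distrib_right by (rule sum.swap)
    also have "\<dots> = (\<Sum>x\<in>carrier G. \<Sum>y\<in>carrier G. g x * cnj (g y) * mat_trace (\<rho> (inv x \<otimes> y)))"
    proof (rule sum.cong[OF refl])
      fix x assume x: "x \<in> carrier G"
      have "(\<Sum>z\<in>carrier G. g x * cnj (g (x \<otimes> z)) * mat_trace (\<rho> z))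
        = (\<Sum>z\<in>carrier G. g x * cnj (g (x \<otimes> z)) * mat_trace (\<rho> (inv x \<otimes> (x \<otimes> z))))"
        using x by (intro sum.cong) (auto simp flip: m_assoc)
      also have "\<dots> = (\<Sum>y\<in>carrier G. g x * cnj (g y) * mat_trace (\<rho> (inv x \<otimes> y)))"
        by (rule sum.reindex_bij_betw[OF bij_betw_mult_left[OF x]])
      finally show "(\<Sum>z\<in>carrier G. g x * cnj (g (x \<otimes> z)) * mat_trace (\<rho> z))
        = (\<Sum>y\<in>carrier G. g x * cnj (g y) * mat_trace (\<rho> (inv x \<otimes> y)))" .
    qed
    also have "\<dots> = (\<Sum>y\<in>carrier G. \<Sum>x\<in>carrier G. g x * cnj (g y) * mat_trace (\<rho> (inv x \<otimes> y)))"
      by (rule sum.swap)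
    also have "\<dots> = (\<Sum>y\<in>carrier G. cnj (g y) * (\<Sum>x\<in>carrier G. g x * mat_trace (\<rho> (inv x \<otimes> y))))"
      by (simp add: sum_distrib_left mult_ac)
    also have "\<dots> = 0" by (simp add: inner)
    finally show ?thesis .
  qed
  obtain \<rho> where \<rho>: "is_rep G (card (carrier G)) \<rho>"
    and tr: "\<And>x. x \<in> carrier G \<Longrightarrow> mat_trace (\<rho> x) = (if x = \<one> then of_nat (card (carrier G)) else 0)"
    using regular_rep[OF fin] by blast
  \<comment> \<open>A nonzero value on the regular representation would already occur on an
    irreducible one, where \<open>vanish\<close> excludes it.\<close>
  have "(\<Sum>z\<in>carrier G. b z * mat_trace (\<rho> z)) = 0"
    using irreducible_constituent[OF \<rho>] vanish by blast
  moreover have "(\<Sum>z\<in>carrier G. b z * mat_trace (\<rho> z))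
      = (\<Sum>z\<in>carrier G. if z = \<one> then b \<one> * of_nat (card (carrier G)) else 0)"
    by (intro sum.cong) (auto simp: tr)
  ultimately have "b \<one> * of_nat (card (carrier G)) = 0" using fin by simp
  moreover have "card (carrier G) > 0" using fin x by (auto simp: card_gt_0_iff)
  ultimately have "b \<one> = 0" by simp
  then have "complex_of_real (\<Sum>x\<in>carrier G. (cmod (g x))\<^sup>2) = complex_of_real 0"
    unfolding b_def by (simp add: complex_norm_square del: of_real_power)
  then have "(\<Sum>x\<in>carrier G. (cmod (g x))\<^sup>2) = 0" using of_real_eq_iff by blast
  then have "(cmod (g x))\<^sup>2 = 0" using fin x by (subst (asm) sum_nonneg_eq_0_iff) auto
  then show ?thesis by simp
qed

section \<open>Conjugacy classes and the second orthogonality relation\<close>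

lemma conj_class_subset: "x \<in> carrier G \<Longrightarrow> conj_class G x \<subseteq> carrier G"
  by (auto simp: conj_class_def)

lemma conj_class_self: "x \<in> carrier G \<Longrightarrow> x \<in> conj_class G x"
  unfolding conj_class_def by (rule CollectI, rule exI[of _ \<one>]) simp

lemma conj_class_conj:
  assumes "x \<in> carrier G" "h \<in> carrier G"
  shows "conj_class G (h \<otimes> x \<otimes> inv h) = conj_class G x"
proof
  show "conj_class G (h \<otimes> x \<otimes> inv h) \<subseteq> conj_class G x"
  proof
    fix z assume "z \<in> conj_class G (h \<otimes> x \<otimes> inv h)"
    then obtain g where "g \<in> carrier G" "z = g \<otimes> (h \<otimes> x \<otimes> inv h) \<otimes> inv g"
      by (auto simp: conj_class_def)
    then have "z = (g \<otimes> h) \<otimes> x \<otimes> inv (g \<otimes> h)" "g \<otimes> h \<in> carrier G"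
      using assms by (simp_all add: inv_mult_group m_assoc)
    then show "z \<in> conj_class G x" unfolding conj_class_def by blast
  qed
  show "conj_class G x \<subseteq> conj_class G (h \<otimes> x \<otimes> inv h)"
  proof
    fix z assume "z \<in> conj_class G x"
    then obtain g where g: "g \<in> carrier G" "z = g \<otimes> x \<otimes> inv g"
      by (auto simp: conj_class_def)
    then have "z = (g \<otimes> inv h) \<otimes> (h \<otimes> x \<otimes> inv h) \<otimes> inv (g \<otimes> inv h)" "g \<otimes> inv h \<in> carrier G"
      using g assms by (simp_all add: inv_mult_group m_assoc inv_mult_cancel_left)
    then show "z \<in> conj_class G (h \<otimes> x \<otimes> inv h)" unfolding conj_class_def by blast
  qed
qed

lemma conj_class_eq: "x \<in> carrier G \<Longrightarrow> y \<in> conj_class G x \<Longrightarrow> conj_class G y = conj_class G x"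
  using conj_class_conj by (auto simp: conj_class_def[of G x])

lemma conj_class_eq_iff:
  "x \<in> carrier G \<Longrightarrow> y \<in> carrier G \<Longrightarrow> y \<in> conj_class G x \<longleftrightarrow> conj_class G y = conj_class G x"
  using conj_class_eq conj_class_self by blast

text \<open>The indicator function of the class of \<open>y\<close> equals its expansion in
  irreducible characters; evaluating the expansion at \<open>x\<close> gives the relation.\<close>

lemma second_orthogonality:
  assumes fin: "finite (carrier G)" and x: "x \<in> carrier G" and y: "y \<in> carrier G"
  shows "of_nat (card (conj_class G y)) * (\<Sum>\<chi>\<in>Irr G. \<chi> x * cnj (\<chi> y))
    = (if x \<in> conj_class G y then of_nat (card (carrier G)) else 0)"
proof -
  define N :: complex where "N = of_nat (card (carrier G))"
  have N: "N \<noteq> 0" using fin x by (auto simp: N_def)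
  define K where "K = conj_class G y"
  have K: "K \<subseteq> carrier G" unfolding K_def by (rule conj_class_subset[OF y])
  define k :: complex where "k = of_nat (card K)"
  \<comment> \<open>The indicator minus its expansion: \<open>k / N * cnj (\<chi> y)\<close> is the
    inner product of the indicator with \<open>\<chi>\<close>, because \<open>\<chi>\<close> is
    constant on \<open>K\<close>.\<close>
  define g where "g = (\<lambda>x. (if x \<in> K then 1 else 0) - k / N * (\<Sum>\<chi>\<in>Irr G. cnj (\<chi> y) * \<chi> x))"
  have "g x = 0"
  proof (rule class_function_eq_zero[OF fin _ _ x])
    fix x h assume x: "x \<in> carrier G" and h: "h \<in> carrier G"
    have "h \<otimes> x \<otimes> inv h \<in> K \<longleftrightarrow> x \<in> K"
      unfolding K_def using x y h conj_class_conj[OF x h]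
      by (subst (1 2) conj_class_eq_iff[OF y]) auto
    moreover have "(\<Sum>\<chi>\<in>Irr G. cnj (\<chi> y) * \<chi> (h \<otimes> x \<otimes> inv h)) = (\<Sum>\<chi>\<in>Irr G. cnj (\<chi> y) * \<chi> x)"
      by (intro sum.cong) (auto simp: Irr_conj_eq[OF _ x h])
    ultimately show "g (h \<otimes> x \<otimes> inv h) = g x" by (simp add: g_def)
  next
    fix \<psi> assume \<psi>: "\<psi> \<in> Irr G"
    have "(\<Sum>x\<in>carrier G. (if x \<in> K then 1 else 0) * cnj (\<psi> x)) = (\<Sum>x\<in>K. cnj (\<psi> x))"
      using K fin by (intro sum.mono_neutral_cong_right) auto
    also have "\<dots> = (\<Sum>x\<in>K. cnj (\<psi> y))"
      by (intro sum.cong) (auto simp: K_def conj_class_def Irr_conj_eq[OF \<psi> y])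
    finally have 1: "(\<Sum>x\<in>carrier G. (if x \<in> K then 1 else 0) * cnj (\<psi> x)) = k * cnj (\<psi> y)"
      by (simp add: k_def)
    have "(\<Sum>x\<in>carrier G. (\<Sum>\<chi>\<in>Irr G. cnj (\<chi> y) * \<chi> x) * cnj (\<psi> x))
        = (\<Sum>\<chi>\<in>Irr G. \<Sum>x\<in>carrier G. cnj (\<chi> y) * \<chi> x * cnj (\<psi> x))"
      unfolding sum_distrib_right by (rule sum.swap)
    also have "\<dots> = (\<Sum>\<chi>\<in>Irr G. cnj (\<chi> y) * (\<Sum>x\<in>carrier G. \<chi> x * cnj (\<psi> x)))"
      by (simp add: sum_distrib_left mult_ac)
    also have "\<dots> = (\<Sum>\<chi>\<in>Irr G. if \<chi> = \<psi> then cnj (\<psi> y) * N else 0)"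
      by (intro sum.cong) (auto simp: Irr_orthonormal[OF fin _ \<psi>] N_def)
    also have "\<dots> = cnj (\<psi> y) * N" using finite_Irr[OF fin] \<psi> by simp
    finally have 2: "(\<Sum>x\<in>carrier G. (\<Sum>\<chi>\<in>Irr G. cnj (\<chi> y) * \<chi> x) * cnj (\<psi> x)) = cnj (\<psi> y) * N" .
    have "(\<Sum>x\<in>carrier G. g x * cnj (\<psi> x))
      = (\<Sum>x\<in>carrier G. (if x \<in> K then 1 else 0) * cnj (\<psi> x))
        - k / N * (\<Sum>x\<in>carrier G. (\<Sum>\<chi>\<in>Irr G. cnj (\<chi> y) * \<chi> x) * cnj (\<psi> x))"
      unfolding g_def left_diff_distrib sum_subtractf mult.assoc sum_distrib_left[symmetric] ..
    then show "(\<Sum>x\<in>carrier G. g x * cnj (\<psi> x)) = 0" unfolding 1 2 using N by simp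
  qed
  then have "k * (\<Sum>\<chi>\<in>Irr G. cnj (\<chi> y) * \<chi> x) = (if x \<in> K then N else 0)"
    using N by (auto simp: g_def field_simps)
  then show ?thesis by (simp add: k_def K_def N_def mult.commute)
qed

end

subsection \<open>Counting classes by power sums\<close>

context group
begin

text \<open>Distributing an \<open>n\<close>-th power over the sum of all characters produces one
  term per tuple. The conjugate comes from the product being the second argument of
  \<open>char_inner\<close>; it disappears later because the sums in question are real. The
  parameter \<open>f\<close> serves both \<open>m_n\<close> and \<open>r_n\<close>.\<close>

lemma sum_char_inner_one:
  assumes "finite (Irr G)"
  shows "(\<Sum>\<chi>s\<in>Pi\<^sub>E {..<n} (\<lambda>_. Irr G). char_inner G (\<lambda>_. 1) (\<lambda>x. \<Prod>i<n. f (\<chi>s i) x))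
    = (\<Sum>x\<in>carrier G. (cnj (\<Sum>\<chi>\<in>Irr G. f \<chi> x)) ^ n) / of_nat (card (carrier G))"
proof -
  have "(cnj (\<Sum>\<chi>\<in>Irr G. f \<chi> x)) ^ n = (\<Sum>\<chi>s\<in>Pi\<^sub>E {..<n} (\<lambda>_. Irr G). cnj (\<Prod>i<n. f (\<chi>s i) x))" for x
    using prod_sum_PiE[of "{..<n}" "\<lambda>_. Irr G" "\<lambda>_ \<chi>. cnj (f \<chi> x)"] assms by simp
  then have "(\<Sum>x\<in>carrier G. (cnj (\<Sum>\<chi>\<in>Irr G. f \<chi> x)) ^ n)
    = (\<Sum>\<chi>s\<in>Pi\<^sub>E {..<n} (\<lambda>_. Irr G). \<Sum>x\<in>carrier G. cnj (\<Prod>i<n. f (\<chi>s i) x))"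
    by (simp only:) (rule sum.swap)
  then show ?thesis by (simp add: char_inner_def sum_divide_distrib)
qed

lemma card_conj_class_pos: "finite (carrier G) \<Longrightarrow> x \<in> carrier G \<Longrightarrow> card (conj_class G x) > 0"
  using conj_class_self[of x] finite_subset[OF conj_class_subset[of x]] by (auto simp: card_gt_0_iff)

lemma m_n_eq:
  assumes fin: "finite (carrier G)"
  shows "m_n n G = (\<Sum>x\<in>carrier G. (of_nat (card (carrier G)) / of_nat (card (conj_class G x))) ^ n)
    / of_nat (card (carrier G))"
proof -
  have "cnj (\<Sum>\<chi>\<in>Irr G. \<chi> x * cnj (\<chi> x)) = of_nat (card (carrier G)) / of_nat (card (conj_class G x))"
    if x: "x \<in> carrier G" for x
  proof -
    have "(\<Sum>\<chi>\<in>Irr G. \<chi> x * cnj (\<chi> x)) = of_nat (card (carrier G)) / of_nat (card (conj_class G x))"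
      using second_orthogonality[OF fin x x] card_conj_class_pos[OF fin x] conj_class_self[OF x]
      by (simp add: field_simps)
    then show ?thesis by (simp del: cnj_sum)
  qed
  then show ?thesis
    unfolding m_n_def sum_char_inner_one[OF finite_Irr[OF fin], of "\<lambda>\<chi> x. \<chi> x * cnj (\<chi> x)"]
    by (simp del: cnj_sum)
qed

lemma real_class_iff:
  assumes x: "x \<in> carrier G"
  shows "real_class G (conj_class G x) \<longleftrightarrow> conj_class G x = conj_class G (inv x)"
proof -
  have "(\<lambda>z. inv z) ` conj_class G x = conj_class G (inv x)"
  proof -
    have "inv (g \<otimes> x \<otimes> inv g) = g \<otimes> inv x \<otimes> inv g" if "g \<in> carrier G" for g
      using that x by (simp add: inv_mult_group m_assoc)
    then show ?thesis unfolding conj_class_def by (force simp: image_iff)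
  qed
  then show ?thesis by (auto simp: real_class_def)
qed

lemma r_n_eq:
  assumes fin: "finite (carrier G)"
  shows "r_n n G = (\<Sum>x\<in>carrier G. (if real_class G (conj_class G x)
      then of_nat (card (carrier G)) / of_nat (card (conj_class G x)) else 0) ^ n)
    / of_nat (card (carrier G))"
proof -
  have "cnj (\<Sum>\<chi>\<in>Irr G. (\<chi> x)\<^sup>2) = (if real_class G (conj_class G x)
      then of_nat (card (carrier G)) / of_nat (card (conj_class G x)) else 0)"
    if x: "x \<in> carrier G" for x
  proof -
    have ix: "inv x \<in> carrier G" using x by simp
    \<comment> \<open>A square is the product of the value at \<open>x\<close> with the conjugate of
      the value at \<open>inv x\<close>, so column orthogonality applies to the classes of these two
      elements.\<close>
    have "(\<Sum>\<chi>\<in>Irr G. (\<chi> x)\<^sup>2) = (\<Sum>\<chi>\<in>Irr G. \<chi> x * cnj (\<chi> (inv x)))"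
      by (intro sum.cong) (auto simp: Irr_inv[OF fin _ x] power2_eq_square)
    also have "\<dots> = (if real_class G (conj_class G x)
      then of_nat (card (carrier G)) / of_nat (card (conj_class G x)) else 0)"
      using second_orthogonality[OF fin x ix] card_conj_class_pos[OF fin ix]
      unfolding real_class_iff[OF x] conj_class_eq_iff[OF ix x]
      by (cases "conj_class G x = conj_class G (inv x)") (simp_all add: field_simps)
    finally show ?thesis by (simp del: cnj_sum)
  qed
  then show ?thesis
    unfolding r_n_def sum_char_inner_one[OF finite_Irr[OF fin], of "\<lambda>\<chi> x. (\<chi> x)\<^sup>2"]
    by (simp del: cnj_sum)
qed

text \<open>Power sums run over elements while the theorem counts classes: the selected classes
  partition the selected elements into blocks of \<open>k\<close>.\<close>

lemma card_classes_of_size: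
  assumes fin: "finite (carrier G)"
  shows "k * card {K \<in> conj_classes G. P K \<and> card K = k}
    = card {x \<in> carrier G. P (conj_class G x) \<and> card (conj_class G x) = k}"
proof -
  let ?C = "{K \<in> conj_classes G. P K \<and> card K = k}"
  let ?X = "{x \<in> carrier G. P (conj_class G x) \<and> card (conj_class G x) = k}"
  have U: "\<Union>?C = ?X"
  proof
    show "\<Union>?C \<subseteq> ?X"
    proof
      fix z assume "z \<in> \<Union>?C"
      then obtain x where x: "x \<in> carrier G" "P (conj_class G x)" "card (conj_class G x) = k"
        "z \<in> conj_class G x"
        by (auto simp: conj_classes_def)
      then show "z \<in> ?X" using conj_class_eq[OF x(1,4)] conj_class_subset[OF x(1)] by auto
    qed
    show "?X \<subseteq> \<Union>?C"
    proof
      fix x assume "x \<in> ?X"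
      then have "conj_class G x \<in> ?C" "x \<in> conj_class G x"
        using conj_class_self by (simp_all add: conj_classes_def)
      then show "x \<in> \<Union>?C" by blast
    qed
  qed
  have "k * card ?C = card (\<Union>?C)"
  proof (rule card_partition)
    show "finite ?C" using fin by (auto simp: conj_classes_def)
    show "finite (\<Union>?C)" unfolding U using fin by simp
    fix K L assume "K \<in> ?C" "L \<in> ?C" "K \<noteq> L"
    then obtain x y where "x \<in> carrier G" "K = conj_class G x" "y \<in> carrier G" "L = conj_class G y"
      by (auto simp: conj_classes_def)
    with \<open>K \<noteq> L\<close> show "K \<inter> L = {}" using conj_class_eq by blast
  qed auto
  then show ?thesis by (simp only: U)
qed

end

section \<open>Recovering multiplicities from power sums\<close>

lemma sum_poly_eq:
  fixes f :: "'a \<Rightarrow> 'c::comm_ring_1"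
  assumes "degree p \<le> N"
  shows "(\<Sum>a\<in>A. poly p (f a)) = (\<Sum>i\<le>N. Polynomial.coeff p i * (\<Sum>a\<in>A. f a ^ i))"
proof -
  have "poly p x = (\<Sum>i\<le>N. Polynomial.coeff p i * x ^ i)" for x
    unfolding poly_altdef using assms by (intro sum.mono_neutral_left) (auto simp: coeff_eq_0)
  then show ?thesis unfolding sum_distrib_left by (simp only:) (rule sum.swap)
qed

text \<open>The test polynomial vanishes at every possible value except \<open>v\<close>. It also vanishes at \<open>0\<close>,
  so no zeroth power sum is needed.\<close>

lemma power_sums_determine_card:
  fixes f :: "'a \<Rightarrow> complex" and g :: "'b \<Rightarrow> complex"
  assumes fin: "finite A" "finite B" "finite V" and V: "0 \<notin> V" "card V \<le> N"
    and f: "f ` A \<subseteq> insert 0 V" and g: "g ` B \<subseteq> insert 0 V"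
    and eq: "\<And>n. n \<in> {1..N} \<Longrightarrow> (\<Sum>a\<in>A. f a ^ n) = (\<Sum>b\<in>B. g b ^ n)"
    and v: "v \<in> V"
  shows "card {a \<in> A. f a = v} = card {b \<in> B. g b = v}"
proof -
  define p :: "complex poly" where "p = [:0, 1:] * (\<Prod>u\<in>V - {v}. [:- u, 1:])"
  have card: "card V = Suc (card (V - {v}))"
    using fin v by (metis card.remove)
  have "degree p \<le> degree [:0, 1::complex:] + degree (\<Prod>u\<in>V - {v}. [:- u, 1:])"
    unfolding p_def by (rule degree_mult_le)
  also have "degree (\<Prod>u\<in>V - {v}. [:- u, 1:]) \<le> (\<Sum>u\<in>V - {v}. degree [:- u, 1:])"
    using degree_prod_sum_le[of "V - {v}" "\<lambda>u. [:- u, 1:]"] fin by (simp add: o_def)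
  \<comment> \<open>The factor for the root 0 raises the degree by one and the omitted root
    \<open>v\<close> lowers it by one, so \<open>card V\<close> is an upper bound and the power sums
    up to \<open>N\<close> suffice.\<close>
  finally have deg: "degree p \<le> N" using card V(2) by simp
  have p0: "Polynomial.coeff p 0 = 0" by (simp add: p_def)
  have pv: "poly p v \<noteq> 0" using v V(1) fin by (auto simp: p_def poly_prod)
  have pz: "poly p u = 0" if "u \<in> insert 0 V" "u \<noteq> v" for u
    using that fin by (auto simp: p_def poly_prod)
  \<comment> \<open>The type of \<open>C\<close> is left free so that the same count applies to
    \<open>A\<close> and to \<open>B\<close>.\<close>
  have count: "(\<Sum>a\<in>C. poly p (h a)) = of_nat (card {a \<in> C. h a = v}) * poly p v"
    if "finite C" "h ` C \<subseteq> insert 0 V" for C :: "'z set" and h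
  proof -
    have "(\<Sum>a\<in>C. poly p (h a)) = (\<Sum>a\<in>{a \<in> C. h a = v}. poly p (h a))"
      using that by (intro sum.mono_neutral_right) (auto intro: pz)
    then show ?thesis by simp
  qed
  have "(\<Sum>a\<in>A. poly p (f a)) = (\<Sum>b\<in>B. poly p (g b))"
    unfolding sum_poly_eq[OF deg]
  proof (rule sum.cong[OF refl])
    fix i assume "i \<in> {..N}"
    then show "Polynomial.coeff p i * (\<Sum>a\<in>A. f a ^ i) = Polynomial.coeff p i * (\<Sum>b\<in>B. g b ^ i)"
      using p0 eq[of i] by (cases "i = 0") auto
  qed
  then show ?thesis
    unfolding count[OF fin(1) f] count[OF fin(2) g] using pv by simp
qed

text \<open>The common core of both parts, with \<open>P\<close> and \<open>Q\<close> either
  constantly true or the two reality predicates. Elements outside the selected classes get the value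
  0, which differs from every \<open>N / k\<close>, so the value at an element reveals whether it is
  selected and how large its class is.\<close>

lemma card_classes_of_size_eq:
  fixes G :: "('a, 'b) monoid_scheme" and H :: "('c, 'd) monoid_scheme"
  assumes G: "group G" "finite (carrier G)" "card (carrier G) = N"
    and H: "group H" "finite (carrier H)" "card (carrier H) = N"
    and eq: "\<And>n. n \<in> {1..N} \<Longrightarrow>
      (\<Sum>x\<in>carrier G. (if P (conj_class G x) then of_nat N / of_nat (card (conj_class G x)) else 0 :: complex) ^ n)
      = (\<Sum>x\<in>carrier H. (if Q (conj_class H x) then of_nat N / of_nat (card (conj_class H x)) else 0) ^ n)"
    and k: "k > 0"
  shows "card {K \<in> conj_classes G. P K \<and> card K = k} = card {K \<in> conj_classes H. Q K \<and> card K = k}"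
proof -
  interpret G: group G by fact
  interpret H: group H by fact
  define f :: "'a \<Rightarrow> complex"
    where "f = (\<lambda>x. if P (conj_class G x) then of_nat N / of_nat (card (conj_class G x)) else 0)"
  define g :: "'c \<Rightarrow> complex"
    where "g = (\<lambda>x. if Q (conj_class H x) then of_nat N / of_nat (card (conj_class H x)) else 0)"
  \<comment> \<open>Admitting every conceivable class size from 1 to \<open>N\<close> bounds
    \<open>card V\<close> by \<open>N\<close>, the number of available power sums.\<close>
  define V :: "complex set" where "V = (\<lambda>j. of_nat N / of_nat j) ` {1..N}"
  have N: "N > 0" using G(2,3) G.one_closed card_gt_0_iff by blast
  have sizeG: "card (conj_class G x) \<in> {1..N}" if "x \<in> carrier G" for x
    using G.card_conj_class_pos[OF G(2) that] card_mono[OF G(2) G.conj_class_subset[OF that]] G(3) by simp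
  have sizeH: "card (conj_class H x) \<in> {1..N}" if "x \<in> carrier H" for x
    using H.card_conj_class_pos[OF H(2) that] card_mono[OF H(2) H.conj_class_subset[OF that]] H(3) by simp
  have inj: "(of_nat N / of_nat i :: complex) = of_nat N / of_nat j \<longleftrightarrow> i = j" if "i > 0" "j > 0" for i j
    using that N by (auto simp: field_simps)
  have "card {x \<in> carrier G. P (conj_class G x) \<and> card (conj_class G x) = k}
    = card {x \<in> carrier H. Q (conj_class H x) \<and> card (conj_class H x) = k}"
  proof (cases "k \<le> N")
    case True
    have "card {x \<in> carrier G. f x = of_nat N / of_nat k} = card {x \<in> carrier H. g x = of_nat N / of_nat k}"
    proof (rule power_sums_determine_card[OF G(2) H(2), of V N])
      show "card V \<le> N" unfolding V_def using card_image_le[of "{1..N}" "\<lambda>j. of_nat N / of_nat j :: complex"] by simp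
      show "f ` carrier G \<subseteq> insert 0 V" using sizeG by (auto simp: f_def V_def)
      show "g ` carrier H \<subseteq> insert 0 V" using sizeH by (auto simp: g_def V_def)
      show "(\<Sum>x\<in>carrier G. f x ^ n) = (\<Sum>x\<in>carrier H. g x ^ n)" if "n \<in> {1..N}" for n
        unfolding f_def g_def by (rule eq[OF that])
    qed (use N k True in \<open>auto simp: V_def\<close>)
    moreover have "{x \<in> carrier G. f x = of_nat N / of_nat k}
      = {x \<in> carrier G. P (conj_class G x) \<and> card (conj_class G x) = k}"
    proof (rule Collect_cong, rule conj_cong[OF refl])
      fix x assume "x \<in> carrier G"
      then show "f x = of_nat N / of_nat k \<longleftrightarrow> P (conj_class G x) \<and> card (conj_class G x) = k"
        using inj[of "card (conj_class G x)" k] sizeG N k by (simp add: f_def)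
    qed
    moreover have "{x \<in> carrier H. g x = of_nat N / of_nat k}
      = {x \<in> carrier H. Q (conj_class H x) \<and> card (conj_class H x) = k}"
    proof (rule Collect_cong, rule conj_cong[OF refl])
      fix x assume "x \<in> carrier H"
      then show "g x = of_nat N / of_nat k \<longleftrightarrow> Q (conj_class H x) \<and> card (conj_class H x) = k"
        using inj[of "card (conj_class H x)" k] sizeH N k by (simp add: g_def)
    qed
    ultimately show ?thesis by simp
  next
    \<comment> \<open>Here \<open>N / k\<close> lies outside \<open>V\<close>, so the power sum
      argument does not reach it; but no class has more than \<open>N\<close> elements.\<close>
    case False
    then have "{x \<in> carrier G. P (conj_class G x) \<and> card (conj_class G x) = k} = {}"
      "{x \<in> carrier H. Q (conj_class H x) \<and> card (conj_class H x) = k} = {}"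
      using sizeG sizeH by auto
    then show ?thesis by (simp only: card.empty)
  qed
  then have "k * card {K \<in> conj_classes G. P K \<and> card K = k}
    = k * card {K \<in> conj_classes H. Q K \<and> card K = k}"
    unfolding G.card_classes_of_size[OF G(2)] H.card_classes_of_size[OF H(2)] .
  then show ?thesis using k by simp
qed

theorem theorem3:
  fixes G :: "('a, 'b) monoid_scheme" and H :: "('c, 'd) monoid_scheme"
  assumes "group G" and "group H"
    and "finite (carrier G)" and "finite (carrier H)"
    and "card (carrier G) = N" and "card (carrier H) = N"
  shows "((\<forall>n\<in>{1..N}. m_n n G = m_n n H) \<longrightarrow>
           (\<forall>k>0. num_classes_of_size G k = num_classes_of_size H k))
       \<and> ((\<forall>n\<in>{1..N}. r_n n G = r_n n H) \<longrightarrow>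
           (\<forall>k>0. num_real_classes_of_size G k = num_real_classes_of_size H k))"
proof (intro conjI impI allI)
  note size_eq = card_classes_of_size_eq[OF assms(1,3,5,2,4,6)]
  have N: "N > 0"
    using assms(3,5) monoid.one_closed[OF group.is_monoid[OF assms(1)]] card_gt_0_iff by blast
  fix k :: nat assume k: "k > 0"
  {
    assume m: "\<forall>n\<in>{1..N}. m_n n G = m_n n H"
    \<comment> \<open>The vacuous condition puts the count of all classes into the form of the
      common core.\<close>
    have "card {K \<in> conj_classes G. True \<and> card K = k} = card {K \<in> conj_classes H. True \<and> card K = k}"
    proof (rule size_eq[OF _ k])
      fix n assume n: "n \<in> {1..N}"
      show "(\<Sum>x\<in>carrier G. (if True then of_nat N / of_nat (card (conj_class G x)) else 0 :: complex) ^ n)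
        = (\<Sum>x\<in>carrier H. (if True then of_nat N / of_nat (card (conj_class H x)) else 0) ^ n)"
        using m[rule_format, OF n] N
        unfolding group.m_n_eq[OF assms(1,3)] group.m_n_eq[OF assms(2,4)] assms(5,6) by simp
    qed
    then show "num_classes_of_size G k = num_classes_of_size H k"
      by (simp add: num_classes_of_size_def)
  next
    assume r: "\<forall>n\<in>{1..N}. r_n n G = r_n n H"
    show "num_real_classes_of_size G k = num_real_classes_of_size H k"
      unfolding num_real_classes_of_size_def
    proof (rule size_eq[OF _ k])
      fix n assume n: "n \<in> {1..N}"
      show "(\<Sum>x\<in>carrier G. (if real_class G (conj_class G x)
          then of_nat N / of_nat (card (conj_class G x)) else 0 :: complex) ^ n)
        = (\<Sum>x\<in>carrier H. (if real_class H (conj_class H x)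
          then of_nat N / of_nat (card (conj_class H x)) else 0) ^ n)"
        using r[rule_format, OF n] N
        unfolding group.r_n_eq[OF assms(1,3)] group.r_n_eq[OF assms(2,4)] assms(5,6) by simp
    qed
  }
qed

end
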